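(* Let $n\ge1$, let $M$ be a smooth oriented $n$-manifold, $(f,\xi)$, $f:M\to\mathbb{R}^{n+1}$, a non-degenerate equiaffine immersion, and $\nu:M\to(\mathbb{R}^{n+1})^*$ its conormal map. The map $\sigma^+:M\to\mathbb{R}^{n+1}\oplus(\mathbb{R}^{n+1})^*$, $\sigma^+(p)=(\xi_p,\nu_p)$, has the following properties: (i) the image of $\sigma^+$ is contained in $\mathbb{S}^{n,n+1}$; (ii) $\sigma^+$ is an immersion; (iii) the induced metric $g_T=(\sigma^+)^*g$ coincides with $\bar h=h(S(\cdot),\cdot)$, namely the induced affine metric on the dual immersion up to a sign; (iv) $\sigma^+$ is horizontal and $\phi$-anti-invariant.
   Context: Everything is smooth. $D$ and $D^*$ are the flat connections on $\mathbb{R}^{n+1}$ and $(\mathbb{R}^{n+1})^*$. Affine immersions. Let $f:M\to\mathbb{R}^{n+1}$ be an immersion with a vector field $\xi:M\to\mathbb{R}^{n+1}$ such that $\mathbb{R}^{n+1}=f_*(T_pM)\oplus\mathbb{R}\xi_p$ for all $p$. Write $D_Xf_*Y=f_*(\nabla_XY)+h(X,Y)\xi$ and $D_X\xi=-f_*(SX)+\tau(X)\xi$; $h$ is the affine metric, $S$ the affine shape operator. $(f,\xi)$ is equiaffine if $\tau=0$, and non-degenerate if $h$ is non-degenerate. The conormal map (dual immersion) $\nu$ is defined by $\nu_p(\xi_p)=1$, $\nu_p(f_*X)=0$ for $X\in T_pM$; its structure equation $D^*_X\nu_*Y=\nu_*(\bar\nabla_XY)-\bar h(X,Y)\nu$ defines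 $\bar h$, so its affine metric is $-\bar h$. Pseudosphere. $V=\mathbb{R}^{n+1}\oplus(\mathbb{R}^{n+1})^*$ with $\hat{\mathbf g}((v,\alpha),(w,\beta))=\tfrac12(\alpha(w)+\beta(v))$ of signature $(n+1,n+1)$. $\mathbb{S}^{n,n+1}=\{(v,\alpha)\in V:\alpha(v)=1\}$ with the restricted metric $g$ of signature $(n,n+1)$. At $z=(v,\alpha)$ put $\zeta_z=(v,-\alpha)\in T_z\mathbb{S}^{n,n+1}$; the horizontal space $\mathcal{H}_z=\{(w,\beta):\alpha(w)=0=\beta(v)\}$ is the $g$-orthogonal complement of $\zeta_z$ in $T_z\mathbb{S}^{n,n+1}$. The endomorphism $\phi$ of $T\mathbb{S}^{n,n+1}$ is given by $\phi(\zeta)=0$ and $\phi(w,\beta)=(w,-\beta)$ on $\mathcal{H}$. A map $\sigma:M\to\mathbb{S}^{n,n+1}$ is horizontal if $\sigma_*(X)\in\mathcal{H}$ for all $X$, and $\phi$-anti-invariant if $g(\phi(\sigma_*X),\sigma_*Y)=0$ for all $X,Y\in\Gamma(TM)$. *)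

theory Defs
  imports "HOL-Analysis.Analysis"
begin

section \<open>Smooth maps between normed spaces\<close>

text \<open>
  Only used for open \<open>S\<close> in a finite-dimensional domain, where this is the usual notion of
  a \<open>k\<close> times continuously differentiable map: iterated directional derivatives in all fixed
  directions exist and are continuous. (Iterating the total derivative would change the type.)
\<close>

primrec Ck_on ::
  "nat \<Rightarrow> 'a::euclidean_space set \<Rightarrow> ('a \<Rightarrow> 'b::real_normed_vector) \<Rightarrow> bool" where
  "Ck_on 0 S f \<longleftrightarrow> continuous_on S f"
| "Ck_on (Suc k) S f \<longleftrightarrow>
     (\<forall>x\<in>S. f differentiable (at x)) \<and> (\<forall>v. Ck_on k S (\<lambda>x. frechet_derivative f (at x) v))"

definition smooth_on :: "'a::euclidean_space set \<Rightarrow> ('a \<Rightarrow> 'b::real_normed_vector) \<Rightarrow> bool" where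
  "smooth_on S f \<longleftrightarrow> (\<forall>k. Ck_on k S f)"


section \<open>Oriented smooth manifolds\<close>

text \<open>
  The underlying set of a manifold is a whole type of class \<open>t2_space\<close> and
  \<open>second_countable_topology\<close>. A chart is a pair of a domain and a coordinate map; the
  coordinate map is irrelevant outside the domain.
\<close>

type_synonym ('m, 'n) chart = "'m set \<times> ('m \<Rightarrow> real ^ 'n)"

definition coord_inv :: "('m, 'n) chart \<Rightarrow> real ^ 'n \<Rightarrow> 'm" where
  "coord_inv c = inv_into (fst c) (snd c)"

definition is_chart :: "('m::topological_space, 'n::finite) chart \<Rightarrow> bool" where
  "is_chart c \<longleftrightarrow> open (fst c) \<and> open (snd c ` fst c) \<and>
     homeomorphism (fst c) (snd c ` fst c) (snd c) (coord_inv c)"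

definition smooth_atlas :: "('m::topological_space, 'n::finite) chart set \<Rightarrow> bool" where
  "smooth_atlas A \<longleftrightarrow>
     (\<forall>c\<in>A. is_chart c) \<and> (\<Union>c\<in>A. fst c) = UNIV \<and>
     (\<forall>c\<in>A. \<forall>d\<in>A. smooth_on (snd c ` (fst c \<inter> fst d)) (snd d \<circ> coord_inv c))"

text \<open>An orientation is given by an atlas all of whose transition maps preserve orientation.\<close>

definition oriented_atlas :: "('m::topological_space, 'n::finite) chart set \<Rightarrow> bool" where
  "oriented_atlas A \<longleftrightarrow> smooth_atlas A \<and>
     (\<forall>c\<in>A. \<forall>d\<in>A. \<forall>x \<in> snd c ` (fst c \<inter> fst d).
        det (matrix (frechet_derivative (snd d \<circ> coord_inv c) (at x))) > 0)"

text \<open>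
  A tangent vector at \<open>p\<close> is the family of its coordinate vectors in all charts around
  \<open>p\<close>, related by the derivatives of the transition maps. The value \<open>0\<close> at all
  other index pairs only serves to make the representation unique; \<open>\<lambda>c. 0\<close> is the zero
  vector.
\<close>

type_synonym ('m, 'n) tvec = "('m, 'n) chart \<Rightarrow> real ^ 'n"

definition tangent_space ::
  "('m::topological_space, 'n::finite) chart set \<Rightarrow> 'm \<Rightarrow> ('m, 'n) tvec set" where
  "tangent_space A p = {v.
     (\<forall>c\<in>A. \<forall>d\<in>A. p \<in> fst c \<inter> fst d \<longrightarrow>
        v d = frechet_derivative (snd d \<circ> coord_inv c) (at (snd c p)) (v c)) \<and>
     (\<forall>c. \<not> (c \<in> A \<and> p \<in> fst c) \<longrightarrow> v c = 0)}"

definition smooth_map ::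
  "('m::topological_space, 'n::finite) chart set \<Rightarrow> ('m \<Rightarrow> 'e::real_normed_vector) \<Rightarrow> bool" where
  "smooth_map A F \<longleftrightarrow> (\<forall>c\<in>A. smooth_on (snd c ` fst c) (F \<circ> coord_inv c))"

definition smooth_vector_field_on ::
  "('m::topological_space, 'n::finite) chart set \<Rightarrow> 'm set \<Rightarrow> ('m \<Rightarrow> ('m, 'n) tvec) \<Rightarrow> bool" where
  "smooth_vector_field_on A U X \<longleftrightarrow>
     (\<forall>p\<in>U. X p \<in> tangent_space A p) \<and>
     (\<forall>c\<in>A. smooth_on (snd c ` (U \<inter> fst c)) (\<lambda>x. X (coord_inv c x) c))"

text \<open>
  The differential of a vector-space-valued map \<open>F\<close>, applied to a tangent vector \<open>v\<close>
  at \<open>p\<close>. It does not depend on the chart. It serves both as the push-forward \<open>F\<^sub>* v\<close>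
  and as the derivative \<open>D\<^sub>v F\<close> with respect to the flat connection of the target.
\<close>

definition differential ::
  "('m::topological_space, 'n::finite) chart set \<Rightarrow> ('m \<Rightarrow> 'e::real_normed_vector) \<Rightarrow>
    'm \<Rightarrow> ('m, 'n) tvec \<Rightarrow> 'e" where
  "differential A F p v =
     (let c = (SOME c. c \<in> A \<and> p \<in> fst c)
      in frechet_derivative (F \<circ> coord_inv c) (at (snd c p)) (v c))"

definition immersion ::
  "('m::topological_space, 'n::finite) chart set \<Rightarrow> ('m \<Rightarrow> 'e::real_normed_vector) \<Rightarrow> bool" where
  "immersion A F \<longleftrightarrow> smooth_map A F \<and> (\<forall>p. inj_on (differential A F p) (tangent_space A p))"


section \<open>Affine immersions\<close>

text \<open>The last two conjuncts say that the target is the direct sum of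
  \<open>f\<^sub>* (T\<^sub>p M)\<close> and the span of \<open>\<xi> p\<close>.\<close>

definition affine_immersion ::
  "('m::topological_space, 'n::finite) chart set \<Rightarrow> ('m \<Rightarrow> 'e::real_normed_vector) \<Rightarrow>
    ('m \<Rightarrow> 'e) \<Rightarrow> bool" where
  "affine_immersion A f \<xi> \<longleftrightarrow> immersion A f \<and> smooth_map A \<xi> \<and>
     (\<forall>p. {x + y | x y. x \<in> differential A f p ` tangent_space A p \<and> y \<in> span {\<xi> p}} = UNIV \<and>
          differential A f p ` tangent_space A p \<inter> span {\<xi> p} = {0})"

text \<open>
  \<open>h(u, v)\<close> is the transversal coefficient in
  \<open>D\<^sub>X f\<^sub>* Y = f\<^sub>* (\<nabla>\<^sub>X Y) + h(X, Y) \<xi>\<close> at \<open>p\<close>, where \<open>X\<close> and \<open>Y\<close>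
  take the values \<open>u\<close> and \<open>v\<close> at \<open>p\<close>; \<open>w\<close> below is the value of
  \<open>\<nabla>\<^sub>X Y\<close>. Only the value of \<open>X\<close> at \<open>p\<close> enters the left-hand side. The field
  \<open>Y\<close> may be defined on any open neighbourhood of \<open>p\<close>.
\<close>

definition affine_metric ::
  "('m::topological_space, 'n::finite) chart set \<Rightarrow> ('m \<Rightarrow> 'e::real_normed_vector) \<Rightarrow>
    ('m \<Rightarrow> 'e) \<Rightarrow> 'm \<Rightarrow> ('m, 'n) tvec \<Rightarrow> ('m, 'n) tvec \<Rightarrow> real" where
  "affine_metric A f \<xi> p u v = (THE a. \<forall>U Y.
     open U \<and> p \<in> U \<and> smooth_vector_field_on A U Y \<and> Y p = v \<longrightarrow>
       (\<exists>w\<in>tangent_space A p.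
          differential A (\<lambda>q. differential A f q (Y q)) p u
            = differential A f p w + a *\<^sub>R \<xi> p))"

text \<open>The two components of \<open>D\<^sub>X \<xi> = - f\<^sub>* (S X) + \<tau>(X) \<xi>\<close>.\<close>

definition affine_shape ::
  "('m::topological_space, 'n::finite) chart set \<Rightarrow> ('m \<Rightarrow> 'e::real_normed_vector) \<Rightarrow>
    ('m \<Rightarrow> 'e) \<Rightarrow> 'm \<Rightarrow> ('m, 'n) tvec \<Rightarrow> ('m, 'n) tvec" where
  "affine_shape A f \<xi> p u = (THE w. w \<in> tangent_space A p \<and>
     (\<exists>a. differential A \<xi> p u = - differential A f p w + a *\<^sub>R \<xi> p))"

definition transversal_form ::
  "('m::topological_space, 'n::finite) chart set \<Rightarrow> ('m \<Rightarrow> 'e::real_normed_vector) \<Rightarrow>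
    ('m \<Rightarrow> 'e) \<Rightarrow> 'm \<Rightarrow> ('m, 'n) tvec \<Rightarrow> real" where
  "transversal_form A f \<xi> p u = (THE a. \<exists>w\<in>tangent_space A p.
     differential A \<xi> p u = - differential A f p w + a *\<^sub>R \<xi> p)"

definition equiaffine ::
  "('m::topological_space, 'n::finite) chart set \<Rightarrow> ('m \<Rightarrow> 'e::real_normed_vector) \<Rightarrow>
    ('m \<Rightarrow> 'e) \<Rightarrow> bool" where
  "equiaffine A f \<xi> \<longleftrightarrow> (\<forall>p. \<forall>u\<in>tangent_space A p. transversal_form A f \<xi> p u = 0)"

definition nondegenerate ::
  "('m::topological_space, 'n::finite) chart set \<Rightarrow> ('m \<Rightarrow> 'e::real_normed_vector) \<Rightarrow>
    ('m \<Rightarrow> 'e) \<Rightarrow> bool" where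
  "nondegenerate A f \<xi> \<longleftrightarrow> (\<forall>p. \<forall>u\<in>tangent_space A p.
     (\<forall>v\<in>tangent_space A p. affine_metric A f \<xi> p u v = 0) \<longrightarrow> u = (\<lambda>c. 0))"

definition conormal ::
  "('m::topological_space, 'n::finite) chart set \<Rightarrow> ('m \<Rightarrow> 'e::real_normed_vector) \<Rightarrow>
    ('m \<Rightarrow> 'e) \<Rightarrow> 'm \<Rightarrow> ('e \<Rightarrow>\<^sub>L real)" where
  "conormal A f \<xi> p = (THE \<alpha>. blinfun_apply \<alpha> (\<xi> p) = 1 \<and>
     (\<forall>u\<in>tangent_space A p. blinfun_apply \<alpha> (differential A f p u) = 0))"

text \<open>
  The form \<open>h'\<close> defined by
  \<open>D\<^sub>X \<nu>\<^sub>* Y = \<nu>\<^sub>* (\<nabla>'\<^sub>X Y) - h'(X, Y) \<nu>\<close> for the conormal map \<open>\<nu>\<close>, so that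
  the affine metric of \<open>\<nu>\<close> with transversal field \<open>\<nu>\<close> is \<open>- h'\<close>.
\<close>

definition dual_form ::
  "('m::topological_space, 'n::finite) chart set \<Rightarrow> ('m \<Rightarrow> 'e::real_normed_vector) \<Rightarrow>
    ('m \<Rightarrow> 'e) \<Rightarrow> 'm \<Rightarrow> ('m, 'n) tvec \<Rightarrow> ('m, 'n) tvec \<Rightarrow> real" where
  "dual_form A f \<xi> p u v = - affine_metric A (conormal A f \<xi>) (conormal A f \<xi>) p u v"


section \<open>The pseudosphere\<close>

text \<open>In finite dimensions the dual space consists of all linear forms, since these are
  automatically bounded.\<close>

type_synonym 'e dbl = "'e \<times> ('e \<Rightarrow>\<^sub>L real)"

definition split_form :: "'e::euclidean_space dbl \<Rightarrow> 'e dbl \<Rightarrow> real" where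
  "split_form x y = (blinfun_apply (snd x) (fst y) + blinfun_apply (snd y) (fst x)) / 2"

definition pseudosphere :: "'e::euclidean_space dbl set" where
  "pseudosphere = {(v, \<alpha>). blinfun_apply \<alpha> v = 1}"

text \<open>The kernel of the differential of \<open>(v, \<alpha>) \<mapsto> \<alpha> v\<close> at \<open>z\<close>.\<close>

definition psph_tangent :: "'e::euclidean_space dbl \<Rightarrow> 'e dbl set" where
  "psph_tangent z = {(w, \<beta>). blinfun_apply (snd z) w + blinfun_apply \<beta> (fst z) = 0}"

definition psph_metric :: "'e::euclidean_space dbl \<Rightarrow> 'e dbl \<Rightarrow> 'e dbl \<Rightarrow> real" where
  "psph_metric z x y =
     (if x \<in> psph_tangent z \<and> y \<in> psph_tangent z then split_form x y else undefined)"

definition reeb :: "'e::euclidean_space dbl \<Rightarrow> 'e dbl" where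
  "reeb z = (fst z, - snd z)"

definition horizontal_space :: "'e::euclidean_space dbl \<Rightarrow> 'e dbl set" where
  "horizontal_space z = {(w, \<beta>). blinfun_apply (snd z) w = 0 \<and> blinfun_apply \<beta> (fst z) = 0}"

text \<open>
  For \<open>z\<close> on the pseudosphere every tangent vector at \<open>z\<close> is uniquely a multiple of
  \<open>reeb z\<close> plus a horizontal vector; \<open>\<phi>\<close> kills the former and acts by
  \<open>(w, \<beta>) \<mapsto> (w, - \<beta>)\<close> on the latter.
\<close>

definition psph_phi :: "'e::euclidean_space dbl \<Rightarrow> 'e dbl \<Rightarrow> 'e dbl" where
  "psph_phi z x = (THE y. \<exists>a w \<beta>.
     (w, \<beta>) \<in> horizontal_space z \<and> x = a *\<^sub>R reeb z + (w, \<beta>) \<and> y = (w, - \<beta>))"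

definition horizontal ::
  "('m::topological_space, 'n::finite) chart set \<Rightarrow> ('m \<Rightarrow> 'e::euclidean_space dbl) \<Rightarrow> bool" where
  "horizontal A \<sigma> \<longleftrightarrow>
     (\<forall>p. \<forall>u\<in>tangent_space A p. differential A \<sigma> p u \<in> horizontal_space (\<sigma> p))"

definition induced_metric ::
  "('m::topological_space, 'n::finite) chart set \<Rightarrow> ('m \<Rightarrow> 'e::euclidean_space dbl) \<Rightarrow>
    'm \<Rightarrow> ('m, 'n) tvec \<Rightarrow> ('m, 'n) tvec \<Rightarrow> real" where
  "induced_metric A \<sigma> p u v =
     psph_metric (\<sigma> p) (differential A \<sigma> p u) (differential A \<sigma> p v)"

definition phi_anti_invariant ::
  "('m::topological_space, 'n::finite) chart set \<Rightarrow> ('m \<Rightarrow> 'e::euclidean_space dbl) \<Rightarrow> bool" where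
  "phi_anti_invariant A \<sigma> \<longleftrightarrow>
     (\<forall>p. \<forall>u\<in>tangent_space A p. \<forall>v\<in>tangent_space A p.
        psph_metric (\<sigma> p) (psph_phi (\<sigma> p) (differential A \<sigma> p u)) (differential A \<sigma> p v) = 0)"

definition sigma_plus ::
  "('m::topological_space, 'n::finite) chart set \<Rightarrow> ('m \<Rightarrow> 'e::euclidean_space) \<Rightarrow>
    ('m \<Rightarrow> 'e) \<Rightarrow> 'm \<Rightarrow> 'e dbl" where
  "sigma_plus A f \<xi> p = (\<xi> p, conormal A f \<xi> p)"

end

(*
  In coordinates, differentiating nu(f_* Y) = 0 gives h(u,v) = - (nu_* u)(f_* v), while nu(xi) = 1
  and tau = 0 give nu(xi_* u) = 0 = (nu_* u)(xi). The second relation makes xi play the role of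
  conormal map for the dual immersion nu, so the same computation, with the roles of the two vector
  spaces exchanged, yields hbar(u,v) = (nu_* v)(xi_* u) = h(v, S u). Both forms are symmetric because
  second derivatives are; this makes the induced metric of (xi, nu), which is the symmetrisation of
  (nu_* v)(xi_* u), equal to hbar, and its skew-symmetrisation, which is g(phi sigma_* u, sigma_* v),
  equal to zero.
*)
theory Submission
  imports Defs
begin

section \<open>Calculus of smooth maps\<close>

text \<open>Two definite descriptions shape the argument. The conormal map is given pointwise, so it
  must be shown smooth before it can be differentiated. The affine metric is the one coefficient
  that serves every local extension of a tangent vector to a field, so computing it takes a
  splitting of the target along the image of the differential and at least one smooth extension. For
  f the splitting is part of being an affine immersion. For \<nu> it has to be proved, and here
  non-degeneracy enters: the kernel of the differential of \<nu> lies in the radical of h, so this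
  differential is injective, and a dimension count then makes \<nu> transversal to its image. The
  differential of (\<xi>, \<nu>) inherits injectivity from its second component. The exchange of the
  two vector spaces is made literal by pairing two maps through an arbitrary bounded bilinear form,
  taken as evaluation in one case and as flipped evaluation in the other.\<close>

lemma has_derivative_cong_open:
  assumes "open S" "x \<in> S" "\<And>y. y \<in> S \<Longrightarrow> f y = g y"
  shows "(f has_derivative f') (at x) \<longleftrightarrow> (g has_derivative f') (at x)"
  using assms has_derivative_transform_within_open[of f f' x UNIV S g]
    has_derivative_transform_within_open[of g f' x UNIV S f] by auto

lemma frechet_derivative_cong_open:
  assumes "open S" "x \<in> S" "\<And>y. y \<in> S \<Longrightarrow> f y = g y"
  shows "frechet_derivative f (at x) = frechet_derivative g (at x)"
  using has_derivative_cong_open[OF assms] unfolding frechet_derivative_def by simp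

text \<open>\<open>Ck_on\<close> refers to full derivatives at the points of S; the values on S
  determine them because S is open.\<close>

lemma Ck_on_cong:
  assumes "open S" "\<And>x. x \<in> S \<Longrightarrow> f x = g x"
  shows "Ck_on k S f \<longleftrightarrow> Ck_on k S g"
proof -
  have "Ck_on k S g" if "Ck_on k S f" "\<And>x. x \<in> S \<Longrightarrow> f x = g x" for f g
    using that
  proof (induction k arbitrary: f g)
    case 0
    then show ?case by (simp cong: continuous_on_cong)
  next
    case (Suc k)
    have fr: "frechet_derivative f (at x) = frechet_derivative g (at x)" if "x \<in> S" for x
      using frechet_derivative_cong_open[OF assms(1) that Suc.prems(2)] .
    have "Ck_on k S (\<lambda>x. frechet_derivative g (at x) v)" for v
      using Suc.IH[of "\<lambda>x. frechet_derivative f (at x) v"] Suc.prems(1) fr by simp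
    moreover have "g differentiable (at x)" if x: "x \<in> S" for x
    proof -
      from Suc.prems(1) x obtain f' where "(f has_derivative f') (at x)"
        by (auto simp: differentiable_def)
      then have "(g has_derivative f') (at x)"
        using has_derivative_cong_open[OF assms(1) x Suc.prems(2)] by simp
      then show ?thesis by (rule differentiableI)
    qed
    ultimately show ?case by simp
  qed
  from this[of f g] this[of g f] show ?thesis using assms(2) by auto
qed

text \<open>Replaces the chosen \<open>frechet_derivative\<close> by any explicit formula for the
  derivative. Closure under addition, products, reciprocals and composition is proved by induction
  on the order through this rule.\<close>

lemma Ck_on_SucI:
  assumes "open S" "\<And>x. x \<in> S \<Longrightarrow> (f has_derivative f' x) (at x)"
    and "\<And>v. Ck_on k S (\<lambda>x. f' x v)"
  shows "Ck_on (Suc k) S f"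
proof -
  have f': "f' x = frechet_derivative f (at x)" if "x \<in> S" for x
    using frechet_derivative_at assms(2)[OF that] by blast
  have "Ck_on k S (\<lambda>x. frechet_derivative f (at x) v)" for v
    by (rule iffD1[OF Ck_on_cong[OF assms(1)] assms(3)]) (simp add: f')
  with assms(2) show ?thesis by (auto simp: differentiable_def)
qed

lemma Ck_on_Suc_has_derivative:
  "Ck_on (Suc k) S f \<Longrightarrow> x \<in> S \<Longrightarrow> (f has_derivative frechet_derivative f (at x)) (at x)"
  using frechet_derivative_works by auto

text \<open>After one differentiation the product and chain rules keep undifferentiated factors, to
  which the induction hypothesis applies only at the lower order.\<close>

lemma Ck_on_Suc_imp: "Ck_on (Suc k) S f \<Longrightarrow> Ck_on k S f"
proof (induction k arbitrary: f)
  case 0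
  then show ?case
    by (auto intro!: continuous_at_imp_continuous_on differentiable_imp_continuous_within)
next
  case (Suc k)
  have "Ck_on k S (\<lambda>x. frechet_derivative f (at x) v)" for v
    using Suc.prems by (intro Suc.IH) simp
  with Suc.prems show ?case by auto
qed

lemma Ck_on_const: "Ck_on k S (\<lambda>x. c)"
  by (induction k arbitrary: c) (auto simp: frechet_derivative_const)

lemma Ck_on_add:
  assumes "open S" "Ck_on k S f" "Ck_on k S g"
  shows "Ck_on k S (\<lambda>x. f x + g x)"
  using assms(2,3)
proof (induction k arbitrary: f g)
  case 0
  then show ?case by (simp add: continuous_on_add)
next
  case (Suc k)
  show ?case
  proof (rule Ck_on_SucI[OF assms(1)])
    fix x assume "x \<in> S"
    then show "((\<lambda>x. f x + g x) has_derivative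
        (\<lambda>v. frechet_derivative f (at x) v + frechet_derivative g (at x) v)) (at x)"
      by (intro has_derivative_add Ck_on_Suc_has_derivative[OF Suc.prems(1)]
          Ck_on_Suc_has_derivative[OF Suc.prems(2)])
  next
    show "Ck_on k S (\<lambda>x. frechet_derivative f (at x) v + frechet_derivative g (at x) v)" for v
      using Suc.prems by (intro Suc.IH) auto
  qed
qed

lemma Ck_on_sum:
  assumes "open S" "\<And>i. i \<in> I \<Longrightarrow> Ck_on k S (f i)"
  shows "Ck_on k S (\<lambda>x. \<Sum>i\<in>I. f i x)"
  using assms(2)
  by (induction I rule: infinite_finite_induct) (auto intro: Ck_on_const Ck_on_add[OF assms(1)])

lemma Ck_on_bilinear:
  assumes "bounded_bilinear B" "open S" "Ck_on k S f" "Ck_on k S g"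
  shows "Ck_on k S (\<lambda>x. B (f x) (g x))"
  using assms(3,4)
proof (induction k arbitrary: f g)
  case 0
  then show ?case using bounded_bilinear.continuous_on[OF assms(1)] by auto
next
  case (Suc k)
  show ?case
  proof (rule Ck_on_SucI[OF assms(2)])
    fix x assume "x \<in> S"
    then show "((\<lambda>x. B (f x) (g x)) has_derivative
        (\<lambda>v. B (f x) (frechet_derivative g (at x) v) + B (frechet_derivative f (at x) v) (g x))) (at x)"
      by (intro bounded_bilinear.FDERIV[OF assms(1)] Ck_on_Suc_has_derivative[OF Suc.prems(1)]
          Ck_on_Suc_has_derivative[OF Suc.prems(2)])
  next
    show "Ck_on k S (\<lambda>x. B (f x) (frechet_derivative g (at x) v)
        + B (frechet_derivative f (at x) v) (g x))" for v
      using Suc.prems Suc.prems[THEN Ck_on_Suc_imp]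
      by (intro Ck_on_add assms Suc.IH) auto
  qed
qed

lemmas Ck_on_mult = Ck_on_bilinear[OF bounded_bilinear_mult]
lemmas Ck_on_scaleR = Ck_on_bilinear[OF bounded_bilinear_scaleR]

lemma Ck_on_linear:
  assumes "bounded_linear L" "open S" "Ck_on k S f"
  shows "Ck_on k S (\<lambda>x. L (f x))"
  using assms(3)
proof (induction k arbitrary: f)
  case 0
  then show ?case using bounded_linear.continuous_on[OF assms(1)] by auto
next
  case (Suc k)
  show ?case
  proof (rule Ck_on_SucI[OF assms(2)])
    fix x assume "x \<in> S"
    then show "((\<lambda>x. L (f x)) has_derivative (\<lambda>v. L (frechet_derivative f (at x) v))) (at x)"
      by (intro bounded_linear.has_derivative[OF assms(1)] Ck_on_Suc_has_derivative[OF Suc.prems])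
  next
    show "Ck_on k S (\<lambda>x. L (frechet_derivative f (at x) v))" for v
      using Suc.prems by (intro Suc.IH) auto
  qed
qed

lemma Ck_on_prod:
  fixes f :: "'i \<Rightarrow> 'a::euclidean_space \<Rightarrow> real"
  assumes "open S" "\<And>i. i \<in> I \<Longrightarrow> Ck_on k S (f i)"
  shows "Ck_on k S (\<lambda>x. \<Prod>i\<in>I. f i x)"
  using assms(2)
  by (induction I rule: infinite_finite_induct) (auto intro: Ck_on_const Ck_on_mult[OF assms(1)])

text \<open>The Leibniz formula exhibits the determinant as a polynomial in the entries. Together
  with reciprocals this makes Cramer quotients as smooth as the entries.\<close>

lemma Ck_on_det:
  fixes M :: "'a::euclidean_space \<Rightarrow> real ^ 'k ^ 'k"
  assumes "open S" "\<And>i j. Ck_on k S (\<lambda>x. M x $ i $ j)"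
  shows "Ck_on k S (\<lambda>x. det (M x))"
  unfolding det_def by (intro Ck_on_sum Ck_on_mult Ck_on_prod Ck_on_const assms)

lemma Ck_on_inverse:
  fixes f :: "'a::euclidean_space \<Rightarrow> real"
  assumes "open S" "Ck_on k S f" "\<And>x. x \<in> S \<Longrightarrow> f x \<noteq> 0"
  shows "Ck_on k S (\<lambda>x. inverse (f x))"
  using assms(2)
proof (induction k)
  case 0
  then show ?case using assms(3) by (auto intro!: continuous_on_inverse)
next
  case (Suc k)
  show ?case
  proof (rule Ck_on_SucI[OF assms(1)])
    fix x assume "x \<in> S"
    then show "((\<lambda>x. inverse (f x)) has_derivative
        (\<lambda>v. - 1 * (inverse (f x) * frechet_derivative f (at x) v * inverse (f x)))) (at x)"
      using Deriv.has_derivative_inverse[OF assms(3) Ck_on_Suc_has_derivative[OF Suc.prems]] by simp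
  next
    \<comment> \<open>The reciprocal recurs in its own derivative, but only to order k, which the
      induction hypothesis covers. The sign is a constant factor \<open>- 1\<close> so that the
      product rule applies.\<close>
    show "Ck_on k S (\<lambda>x. - 1 * (inverse (f x) * frechet_derivative f (at x) v * inverse (f x)))" for v
      using Suc.prems Ck_on_Suc_imp[OF Suc.prems]
      by (intro Ck_on_mult Ck_on_const assms Suc.IH) auto
  qed
qed

lemma linear_eq_sum_Basis:
  fixes L :: "'a::euclidean_space \<Rightarrow> 'b::real_vector"
  assumes "linear L"
  shows "L v = (\<Sum>b\<in>Basis. (v \<bullet> b) *\<^sub>R L b)"
proof -
  have "L v = L (\<Sum>b\<in>Basis. (v \<bullet> b) *\<^sub>R b)" by (simp add: euclidean_representation)
  also have "\<dots> = (\<Sum>b\<in>Basis. (v \<bullet> b) *\<^sub>R L b)"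
    by (simp add: linear_sum[OF assms] linear_cmul[OF assms])
  finally show ?thesis .
qed

text \<open>\<open>Ck_on\<close> controls derivatives in fixed directions only, while the chain rule
  differentiates g in the moving direction given by the derivative of f. Expanding that direction in
  the standard basis leaves a finite sum of scalar functions times fixed-direction derivatives of g
  composed with f.\<close>

lemma Ck_on_compose:
  fixes f :: "'a::euclidean_space \<Rightarrow> 'b::euclidean_space"
  assumes "open S" "f ` S \<subseteq> T" "Ck_on k S f" "Ck_on k T g"
  shows "Ck_on k S (\<lambda>x. g (f x))"
  using assms(3,4)
proof (induction k arbitrary: g)
  case 0
  then show ?case using continuous_on_compose2[OF _ _ assms(2)] by auto
next
  case (Suc k)
  show ?case
  proof (rule Ck_on_SucI[OF assms(1)])
    fix x assume x: "x \<in> S"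
    let ?f' = "frechet_derivative f (at x)" and ?g' = "frechet_derivative g (at (f x))"
    have g': "(g has_derivative ?g') (at (f x))"
      using Ck_on_Suc_has_derivative[OF Suc.prems(2)] x assms(2) by blast
    have "(\<lambda>v. ?g' (?f' v)) = (\<lambda>v. \<Sum>b\<in>Basis. (?f' v \<bullet> b) *\<^sub>R ?g' b)"
      using linear_eq_sum_Basis[OF has_derivative_linear[OF g']] by blast
    then show "((\<lambda>x. g (f x)) has_derivative (\<lambda>v. \<Sum>b\<in>Basis. (?f' v \<bullet> b) *\<^sub>R ?g' b)) (at x)"
      using has_derivative_compose[OF Ck_on_Suc_has_derivative[OF Suc.prems(1) x] g'] by simp
  next
    show "Ck_on k S (\<lambda>x. \<Sum>b\<in>Basis. (frechet_derivative f (at x) v \<bullet> b)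
        *\<^sub>R frechet_derivative g (at (f x)) b)" for v
      using Suc.prems Ck_on_Suc_imp[OF Suc.prems(1)]
      by (intro Ck_on_sum Ck_on_scaleR Suc.IH Ck_on_linear[OF bounded_linear_inner_left] assms) auto
  qed
qed

lemma smooth_on_derivative:
  "smooth_on S f \<Longrightarrow> smooth_on S (\<lambda>x. frechet_derivative f (at x) v)"
  unfolding smooth_on_def using Ck_on.simps(2) by blast

lemma smooth_on_has_derivative:
  "smooth_on S f \<Longrightarrow> x \<in> S \<Longrightarrow> (f has_derivative frechet_derivative f (at x)) (at x)"
  unfolding smooth_on_def using Ck_on_Suc_has_derivative by blast

lemma smooth_on_continuous: "smooth_on S f \<Longrightarrow> continuous_on S f"
  unfolding smooth_on_def using Ck_on.simps(1) by blast

lemma smooth_on_Ck: "smooth_on S f \<Longrightarrow> Ck_on k S f"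
  unfolding smooth_on_def by blast

lemma smooth_on_linear: "bounded_linear L \<Longrightarrow> open S \<Longrightarrow> smooth_on S f \<Longrightarrow> smooth_on S (\<lambda>x. L (f x))"
  unfolding smooth_on_def using Ck_on_linear by blast

lemma Ck_on_restrict: "Ck_on k S f \<Longrightarrow> T \<subseteq> S \<Longrightarrow> Ck_on k T f"
  by (induction k arbitrary: f) (auto intro: continuous_on_subset)

lemma smooth_on_restrict: "smooth_on S f \<Longrightarrow> T \<subseteq> S \<Longrightarrow> smooth_on T f"
  unfolding smooth_on_def using Ck_on_restrict by blast

lemma smooth_on_cong: "open S \<Longrightarrow> (\<And>x. x \<in> S \<Longrightarrow> f x = g x) \<Longrightarrow> smooth_on S f \<longleftrightarrow> smooth_on S g"
  unfolding smooth_on_def using Ck_on_cong by blast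

section \<open>Symmetry of second derivatives\<close>

text \<open>By the mean value theorem along u and then along v, the second difference over the
  parallelogram spanned by \<open>t *\<^sub>R u\<close> and \<open>t *\<^sub>R v\<close> is
  \<open>t * t\<close> times the mixed derivative at a nearby point; continuity of the mixed
  derivative does the rest.\<close>

lemma second_difference_approx:
  fixes g :: "'a::euclidean_space \<Rightarrow> real"
  assumes S: "open S" "x \<in> S" and g: "smooth_on S g" and e: "e > 0"
  shows "\<exists>d>0. \<forall>t. 0 < t \<and> t < d \<longrightarrow>
    \<bar>(g (x + t *\<^sub>R u + t *\<^sub>R v) - g (x + t *\<^sub>R u) - g (x + t *\<^sub>R v) + g x) / (t * t)
      - frechet_derivative (\<lambda>y. frechet_derivative g (at y) u) (at x) v\<bar> < e"
proof -
  let ?gu = "\<lambda>y. frechet_derivative g (at y) u"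
  let ?k = "\<lambda>y. frechet_derivative ?gu (at y) v"
  have gu: "smooth_on S ?gu" and k: "smooth_on S ?k"
    using g smooth_on_derivative by blast+
  have "isCont ?k x"
    using smooth_on_continuous[OF k] S continuous_on_eq_continuous_at by blast
  then obtain r where r: "r > 0" "\<And>y. dist y x < r \<Longrightarrow> \<bar>?k y - ?k x\<bar> < e"
    using e unfolding continuous_at_eps_delta dist_real_def by blast
  obtain r' where r': "r' > 0" "ball x r' \<subseteq> S"
    using S open_contains_ball by blast
  define R where "R = min r r'"
  \<comment> \<open>Steps shorter than d in both directions stay within distance R of x; the summand
    1 keeps the denominator positive when u and v vanish.\<close>
  define d where "d = R / (norm u + norm v + 1)"
  have pos: "norm u + norm v + 1 > 0" by (simp add: add_nonneg_pos)
  have R: "R > 0" using r r' R_def by simp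
  then have d: "d > 0" using pos by (simp add: d_def)
  have near: "dist (x + s *\<^sub>R u + q *\<^sub>R v) x < R" if "0 \<le> s" "s < d" "0 \<le> q" "q < d" for s q
  proof -
    have "dist (x + s *\<^sub>R u + q *\<^sub>R v) x = norm (s *\<^sub>R u + q *\<^sub>R v)"
      by (simp add: dist_norm add.assoc)
    also have "\<dots> \<le> s * norm u + q * norm v"
      using norm_triangle_ineq[of "s *\<^sub>R u" "q *\<^sub>R v"] that by simp
    also have "\<dots> \<le> d * norm u + d * norm v"
      using that by (intro add_mono mult_right_mono) auto
    also have "\<dots> < d * (norm u + norm v + 1)" using d by (simp add: algebra_simps)
    also have "\<dots> = R" using pos by (simp add: d_def)
    finally show ?thesis .
  qed
  then have inS: "x + s *\<^sub>R u + q *\<^sub>R v \<in> S" if "0 \<le> s" "s < d" "0 \<le> q" "q < d" for s q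
    using that r'(2) by (force simp: R_def mem_ball dist_commute)
  have "\<bar>(g (x + t *\<^sub>R u + t *\<^sub>R v) - g (x + t *\<^sub>R u) - g (x + t *\<^sub>R v) + g x) / (t * t) - ?k x\<bar> < e"
    if t: "0 < t" "t < d" for t
  proof -
    have dir: "((\<lambda>s. h (y + s *\<^sub>R w)) has_real_derivative frechet_derivative h (at (y + s *\<^sub>R w)) w) (at s)"
      if "smooth_on S h" "y + s *\<^sub>R w \<in> S" for h :: "'a \<Rightarrow> real" and y w s
    proof -
      have h': "(h has_derivative frechet_derivative h (at (y + s *\<^sub>R w))) (at (y + s *\<^sub>R w))"
        using smooth_on_has_derivative that by blast
      have "((\<lambda>s. y + s *\<^sub>R w) has_derivative (\<lambda>q. q *\<^sub>R w)) (at s)"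
        by (auto intro!: derivative_eq_intros)
      from has_derivative_compose[OF this h']
      have "((\<lambda>s. h (y + s *\<^sub>R w)) has_derivative
          (\<lambda>q. frechet_derivative h (at (y + s *\<^sub>R w)) (q *\<^sub>R w))) (at s)" .
      then show ?thesis
        unfolding has_field_derivative_def
        using linear_cmul[OF has_derivative_linear[OF h']]
        by (simp add: mult.commute[of _ "frechet_derivative h _ _"])
    qed
    \<comment> \<open>The mean value theorem is applied to the difference of g along two parallel
      lines in direction u, which leaves a difference of first derivatives at points displaced by
      \<open>t *\<^sub>R v\<close> for the second application.\<close>
    have "\<exists>s>0. s < t \<and>
        (g (x + t *\<^sub>R v + t *\<^sub>R u) - g (x + t *\<^sub>R u)) - (g (x + t *\<^sub>R v + 0 *\<^sub>R u) - g (x + 0 *\<^sub>R u))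
        = (t - 0) * (?gu (x + t *\<^sub>R v + s *\<^sub>R u) - ?gu (x + s *\<^sub>R u))"
    proof (rule MVT2)
      fix s assume s: "0 \<le> s" "s \<le> t"
      have "x + t *\<^sub>R v + s *\<^sub>R u \<in> S" "x + s *\<^sub>R u \<in> S"
        using inS[of s t] inS[of s 0] s t by (auto simp: algebra_simps)
      then show "((\<lambda>s. g (x + t *\<^sub>R v + s *\<^sub>R u) - g (x + s *\<^sub>R u)) has_real_derivative
          ?gu (x + t *\<^sub>R v + s *\<^sub>R u) - ?gu (x + s *\<^sub>R u)) (at s)"
        by (intro DERIV_diff dir g)
    qed (use t in auto)
    then obtain s where s: "0 < s" "s < t"
      "g (x + t *\<^sub>R u + t *\<^sub>R v) - g (x + t *\<^sub>R u) - g (x + t *\<^sub>R v) + g x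
        = t * (?gu (x + s *\<^sub>R u + t *\<^sub>R v) - ?gu (x + s *\<^sub>R u))"
      by (auto simp: algebra_simps)
    have "\<exists>q>0. q < t \<and> ?gu (x + s *\<^sub>R u + t *\<^sub>R v) - ?gu (x + s *\<^sub>R u + 0 *\<^sub>R v)
        = (t - 0) * ?k (x + s *\<^sub>R u + q *\<^sub>R v)"
      using s t by (intro MVT2 dir gu inS) auto
    then obtain q where q: "0 < q" "q < t"
      "?gu (x + s *\<^sub>R u + t *\<^sub>R v) - ?gu (x + s *\<^sub>R u) = t * ?k (x + s *\<^sub>R u + q *\<^sub>R v)"
      by auto
    have "(g (x + t *\<^sub>R u + t *\<^sub>R v) - g (x + t *\<^sub>R u) - g (x + t *\<^sub>R v) + g x) / (t * t)
        = ?k (x + s *\<^sub>R u + q *\<^sub>R v)"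
      using s(3) q(3) t by simp
    moreover have "dist (x + s *\<^sub>R u + q *\<^sub>R v) x < r"
      using near[of s q] s q t by (simp add: R_def)
    ultimately show ?thesis using r(2) by metis
  qed
  then show ?thesis using d by blast
qed

text \<open>The second difference is unchanged when u and v are swapped, so both mixed derivatives
  are limits of the same quotient. Real values suffice, since vector-valued maps will be paired with
  a fixed covector before being differentiated twice.\<close>

lemma smooth_on_second_derivative_sym:
  fixes g :: "'a::euclidean_space \<Rightarrow> real"
  assumes "open S" "x \<in> S" "smooth_on S g"
  shows "frechet_derivative (\<lambda>y. frechet_derivative g (at y) u) (at x) v
    = frechet_derivative (\<lambda>y. frechet_derivative g (at y) v) (at x) u" (is "?a = ?b")
proof (rule ccontr)
  assume "?a \<noteq> ?b"
  then have e: "\<bar>?a - ?b\<bar> / 2 > 0" by simp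
  let ?D = "\<lambda>t. (g (x + t *\<^sub>R u + t *\<^sub>R v) - g (x + t *\<^sub>R u) - g (x + t *\<^sub>R v) + g x) / (t * t)"
  obtain d where d: "d > 0" "\<And>t. 0 < t \<Longrightarrow> t < d \<Longrightarrow> \<bar>?D t - ?a\<bar> < \<bar>?a - ?b\<bar> / 2"
    using second_difference_approx[OF assms e, of u v] by auto
  obtain d' where d': "d' > 0" "\<And>t. 0 < t \<Longrightarrow> t < d' \<Longrightarrow> \<bar>?D t - ?b\<bar> < \<bar>?a - ?b\<bar> / 2"
    using second_difference_approx[OF assms e, of v u] by (auto simp: algebra_simps)
  define t where "t = min d d' / 2"
  have "0 < t" "t < d" "t < d'" using d d' by (auto simp: t_def)
  then have "\<bar>?D t - ?a\<bar> + \<bar>?D t - ?b\<bar> < \<bar>?a - ?b\<bar> / 2 + \<bar>?a - ?b\<bar> / 2"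
    by (intro add_strict_mono d(2) d'(2))
  moreover have "\<bar>?a - ?b\<bar> \<le> \<bar>?D t - ?a\<bar> + \<bar>?D t - ?b\<bar>" by simp
  ultimately show False unfolding field_sum_of_halves by (meson not_le)
qed


section \<open>Charts and tangent vectors\<close>

lemma has_derivative_unique_frechet:
  "(f has_derivative f') (at x) \<Longrightarrow> frechet_derivative f (at x) = f'"
  using frechet_derivative_at by metis

text \<open>Inverse of the coordinate map \<open>v \<mapsto> v c\<close> on the tangent space at p.
  For fixed e and varying p it is a field with constant coordinates in the chart c.\<close>

definition tvec ::
  "('m::topological_space, 'n::finite) chart set \<Rightarrow> ('m, 'n) chart \<Rightarrow> 'm \<Rightarrow> real ^ 'n \<Rightarrow> ('m, 'n) tvec"
  where "tvec A c p e = (\<lambda>d. if d \<in> A \<and> p \<in> fst d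
    then frechet_derivative (snd d \<circ> coord_inv c) (at (snd c p)) e else 0)"

context
  fixes A :: "('m::topological_space, 'n::finite) chart set"
  assumes A: "smooth_atlas A"
begin

lemma chart_homeomorphism:
  "c \<in> A \<Longrightarrow> homeomorphism (fst c) (snd c ` fst c) (snd c) (coord_inv c)"
  using A unfolding smooth_atlas_def is_chart_def by blast

lemma open_chart_domain: "c \<in> A \<Longrightarrow> open (fst c)"
  using A unfolding smooth_atlas_def is_chart_def by blast

lemma coord_inv_coord: "c \<in> A \<Longrightarrow> p \<in> fst c \<Longrightarrow> coord_inv c (snd c p) = p"
  using chart_homeomorphism homeomorphism_apply1 by blast

lemma open_chart_image:
  assumes "c \<in> A" "open U"
  shows "open (snd c ` (U \<inter> fst c))"
proof -
  have "openin (top_of_set (fst c)) (U \<inter> fst c)"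
    using assms(2) by (metis Int_commute openin_open_Int)
  then have "openin (top_of_set (snd c ` fst c)) (snd c ` (U \<inter> fst c))"
    using homeomorphism_imp_open_map[OF chart_homeomorphism[OF assms(1)]] by blast
  moreover have "open (snd c ` fst c)"
    using A assms(1) unfolding smooth_atlas_def is_chart_def by blast
  ultimately show ?thesis using openin_open_trans by blast
qed

lemma open_chart_range: "c \<in> A \<Longrightarrow> open (snd c ` fst c)"
  using open_chart_image[of c UNIV] by simp

lemma transition_smooth:
  "c \<in> A \<Longrightarrow> d \<in> A \<Longrightarrow> smooth_on (snd c ` (fst c \<inter> fst d)) (snd d \<circ> coord_inv c)"
  using A unfolding smooth_atlas_def by blast

lemma ex_chart: "\<exists>c\<in>A. p \<in> fst c"
  using A unfolding smooth_atlas_def by blast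

text \<open>Chain rule through the transition map: \<open>F \<circ> coord_inv c\<close> agrees with
  the composite on the overlap of the two domains, whose image is open. F may itself be a coordinate
  map.\<close>

lemma has_derivative_change_chart:
  assumes c: "c \<in> A" "p \<in> fst c" and d: "d \<in> A" "p \<in> fst d"
    and F: "(F \<circ> coord_inv d has_derivative F') (at (snd d p))"
  shows "(F \<circ> coord_inv c has_derivative
    (\<lambda>v. F' (frechet_derivative (snd d \<circ> coord_inv c) (at (snd c p)) v))) (at (snd c p))"
proof -
  let ?W = "snd c ` (fst d \<inter> fst c)"
  have W: "open ?W" "snd c p \<in> ?W"
    using open_chart_image[OF c(1) open_chart_domain[OF d(1)]] c d by auto
  have "((snd d \<circ> coord_inv c) has_derivative
      frechet_derivative (snd d \<circ> coord_inv c) (at (snd c p))) (at (snd c p))"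
    using smooth_on_has_derivative[OF transition_smooth[OF c(1) d(1)]] W by (simp add: Int_commute)
  moreover have "(F \<circ> coord_inv d has_derivative F') (at ((snd d \<circ> coord_inv c) (snd c p)))"
    using F coord_inv_coord[OF c] by simp
  ultimately have "((\<lambda>x. (F \<circ> coord_inv d) ((snd d \<circ> coord_inv c) x)) has_derivative
      (\<lambda>v. F' (frechet_derivative (snd d \<circ> coord_inv c) (at (snd c p)) v))) (at (snd c p))"
    by (rule has_derivative_compose)
  then show ?thesis
  proof (rule iffD1[OF has_derivative_cong_open[OF W], rotated])
    show "(F \<circ> coord_inv d) ((snd d \<circ> coord_inv c) x) = (F \<circ> coord_inv c) x" if "x \<in> ?W" for x
      using that coord_inv_coord[OF c(1)] coord_inv_coord[OF d(1)] by auto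
  qed
qed

lemma transition_has_derivative:
  assumes "c \<in> A" "p \<in> fst c" "d \<in> A" "p \<in> fst d"
  shows "(snd d \<circ> coord_inv c has_derivative
    frechet_derivative (snd d \<circ> coord_inv c) (at (snd c p))) (at (snd c p))"
  using smooth_on_has_derivative[OF transition_smooth] assms by blast

lemma tvec_in_tangent_space:
  assumes c: "c \<in> A" "p \<in> fst c"
  shows "tvec A c p e \<in> tangent_space A p"
proof -
  \<comment> \<open>The cocycle rule is the change of charts between d and c, applied to the
    coordinate map \<open>snd d'\<close>.\<close>
  have cocycle: "frechet_derivative (snd d' \<circ> coord_inv c) (at (snd c p)) e =
      frechet_derivative (snd d' \<circ> coord_inv d) (at (snd d p))
        (frechet_derivative (snd d \<circ> coord_inv c) (at (snd c p)) e)"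
    if "d \<in> A" "d' \<in> A" "p \<in> fst d" "p \<in> fst d'" for d d'
    using fun_cong[OF has_derivative_unique_frechet[OF has_derivative_change_chart[OF c that(1,3)
          transition_has_derivative[OF that(1,3,2,4)]]]] .
  show ?thesis
    unfolding tangent_space_def
  proof (rule CollectI, intro conjI ballI allI impI)
    fix d d' assume "d \<in> A" "d' \<in> A" "p \<in> fst d \<inter> fst d'"
    then show "tvec A c p e d' = frechet_derivative (snd d' \<circ> coord_inv d) (at (snd d p)) (tvec A c p e d)"
      unfolding tvec_def using cocycle[of d d'] by simp
  qed (auto simp: tvec_def)
qed

lemma tvec_coord:
  assumes c: "c \<in> A" "p \<in> fst c"
  shows "tvec A c p e c = e"
proof -
  have "(snd c \<circ> coord_inv c has_derivative (\<lambda>x. x)) (at (snd c p))"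
  proof (rule iffD2[OF has_derivative_cong_open[OF open_chart_range[OF c(1)]]])
    show "snd c p \<in> snd c ` fst c" using c by blast
    show "(snd c \<circ> coord_inv c) x = x" if "x \<in> snd c ` fst c" for x
      using that coord_inv_coord[OF c(1)] by auto
  qed simp
  from has_derivative_unique_frechet[OF this] show ?thesis using c by (simp add: tvec_def)
qed

lemma tangent_eq_tvec:
  assumes "c \<in> A" "p \<in> fst c" "v \<in> tangent_space A p"
  shows "tvec A c p (v c) = v"
proof
  fix d
  show "tvec A c p (v c) d = v d"
  proof (cases "d \<in> A \<and> p \<in> fst d")
    case True
    then have "v d = frechet_derivative (snd d \<circ> coord_inv c) (at (snd c p)) (v c)"
      using assms unfolding tangent_space_def by blast
    with True show ?thesis by (simp only: tvec_def simp_thms if_True)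
  next
    case False
    then have "v d = 0" using assms(3) unfolding tangent_space_def by blast
    with False show ?thesis by (simp only: tvec_def simp_thms if_False)
  qed
qed

text \<open>Frees \<open>differential\<close> from the chart picked by the choice operator: the
  transformation rule in \<open>tangent_space\<close> compensates exactly for the change of
  charts.\<close>

lemma differential_eq:
  assumes c: "c \<in> A" "p \<in> fst c" and v: "v \<in> tangent_space A p"
    and F: "(F \<circ> coord_inv c has_derivative F') (at (snd c p))"
  shows "differential A F p v = F' (v c)"
proof -
  define d where "d = (SOME c. c \<in> A \<and> p \<in> fst c)"
  have d: "d \<in> A" "p \<in> fst d"
    using someI[of "\<lambda>c. c \<in> A \<and> p \<in> fst c" c] c unfolding d_def by blast+
  have "frechet_derivative (F \<circ> coord_inv d) (at (snd d p)) =
      (\<lambda>v. F' (frechet_derivative (snd c \<circ> coord_inv d) (at (snd d p)) v))"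
    using has_derivative_unique_frechet[OF has_derivative_change_chart[OF d c F]] .
  moreover have "v c = frechet_derivative (snd c \<circ> coord_inv d) (at (snd d p)) (v d)"
    using v c d unfolding tangent_space_def by blast
  ultimately show ?thesis unfolding differential_def d_def[symmetric] Let_def by simp
qed

lemma smooth_map_has_derivative:
  assumes "smooth_map A F" "c \<in> A" "p \<in> fst c"
  shows "(F \<circ> coord_inv c has_derivative
    frechet_derivative (F \<circ> coord_inv c) (at (snd c p))) (at (snd c p))"
  using smooth_on_has_derivative assms unfolding smooth_map_def by blast

lemma differential_tvec:
  assumes "smooth_map A F" "c \<in> A" "p \<in> fst c"
  shows "differential A F p (tvec A c p e) = frechet_derivative (F \<circ> coord_inv c) (at (snd c p)) e"
  using differential_eq[OF assms(2,3) tvec_in_tangent_space[OF assms(2,3)] smooth_map_has_derivative[OF assms]]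
  by (simp only: tvec_coord[OF assms(2,3)])

lemma differential_coord:
  assumes "smooth_map A F" "c \<in> A" "p \<in> fst c" "v \<in> tangent_space A p"
  shows "differential A F p v = frechet_derivative (F \<circ> coord_inv c) (at (snd c p)) (v c)"
  using differential_eq smooth_map_has_derivative assms by blast

text \<open>Supplies the local extension of a tangent vector over which \<open>affine_metric\<close>
  quantifies. In another chart its coordinates are a derivative of the transition map composed with
  the inverse transition.\<close>

lemma smooth_tvec_field:
  assumes c: "c \<in> A"
  shows "smooth_vector_field_on A (fst c) (\<lambda>q. tvec A c q e)"
  unfolding smooth_vector_field_on_def
proof (intro conjI ballI)
  show "tvec A c q e \<in> tangent_space A q" if "q \<in> fst c" for q
    using tvec_in_tangent_space c that by blast
next
  fix d assume d: "d \<in> A"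
  let ?S = "snd d ` (fst c \<inter> fst d)" and ?T = "snd c ` (fst c \<inter> fst d)"
  let ?g = "\<lambda>y. frechet_derivative (snd d \<circ> coord_inv c) (at y) e"
  have S: "open ?S" using open_chart_image[OF d open_chart_domain[OF c]] .
  have "smooth_on ?S (\<lambda>x. ?g ((snd c \<circ> coord_inv d) x))"
    unfolding smooth_on_def
  proof
    fix k
    show "Ck_on k ?S (\<lambda>x. ?g ((snd c \<circ> coord_inv d) x))"
    proof (rule Ck_on_compose[OF S, where T = ?T and g = ?g and f = "snd c \<circ> coord_inv d"])
      show "(snd c \<circ> coord_inv d) ` ?S \<subseteq> ?T" using coord_inv_coord[OF d] by auto
      show "Ck_on k ?S (snd c \<circ> coord_inv d)"
        using transition_smooth[OF d c] by (simp add: Int_commute smooth_on_Ck)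
      show "Ck_on k ?T ?g"
        using transition_smooth[OF c d] smooth_on_derivative smooth_on_Ck by blast
    qed
  qed
  moreover have "?g ((snd c \<circ> coord_inv d) x) = tvec A c (coord_inv d x) e d" if "x \<in> ?S" for x
    using that coord_inv_coord[OF d] d by (auto simp: tvec_def)
  ultimately show "smooth_on ?S (\<lambda>x. tvec A c (coord_inv d x) e d)"
    by (rule iffD1[OF smooth_on_cong[OF S], rotated])
qed

section \<open>The affine metric of a map with an annihilating dual map\<close>

context
  fixes F :: "'m \<Rightarrow> 'e::real_normed_vector" and N :: "'m \<Rightarrow> 'd::real_normed_vector"
    and B :: "'d \<Rightarrow> 'e \<Rightarrow> real"
  assumes F: "smooth_map A F" and N: "smooth_map A N" and B: "bounded_bilinear B"
    and NF: "\<And>q w. w \<in> tangent_space A q \<Longrightarrow> B (N q) (differential A F q w) = 0"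
begin

text \<open>The pairing of N with the push-forward of Y vanishes throughout U, so the two terms of
  its derivative along u cancel. Only \<open>Y p\<close> survives on the right, which makes the
  result independent of the extension.\<close>

lemma pairing_derivative:
  assumes U: "open U" "p \<in> U" and Y: "smooth_vector_field_on A U Y"
    and u: "u \<in> tangent_space A p"
  shows "B (N p) (differential A (\<lambda>q. differential A F q (Y q)) p u)
    = - B (differential A N p u) (differential A F p (Y p))"
proof -
  obtain c where c: "c \<in> A" "p \<in> fst c" using ex_chart by blast
  let ?W = "snd c ` (U \<inter> fst c)" and ?F = "F \<circ> coord_inv c" and ?N = "N \<circ> coord_inv c"
  let ?G = "(\<lambda>q. differential A F q (Y q)) \<circ> coord_inv c"
  let ?Y = "\<lambda>x. Y (coord_inv c x) c"
  have W: "open ?W" "snd c p \<in> ?W" using open_chart_image[OF c(1) U(1)] U c by auto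
  have Fs: "smooth_on ?W ?F"
    using F c smooth_on_restrict[of "snd c ` fst c" ?F ?W] unfolding smooth_map_def by auto
  have Ys: "smooth_on ?W ?Y" using Y c unfolding smooth_vector_field_on_def by blast
  \<comment> \<open>Expanding the moving direction Y in the standard basis leaves derivatives of F
    in fixed directions, whose smoothness is known.\<close>
  have G: "(\<Sum>b\<in>Basis. (?Y x \<bullet> b) *\<^sub>R frechet_derivative ?F (at x) b) = ?G x" if x: "x \<in> ?W" for x
  proof -
    obtain q where q: "q \<in> U" "q \<in> fst c" "x = snd c q" using x by blast
    have "?G x = frechet_derivative ?F (at x) (?Y x)"
      using differential_coord[OF F c(1) q(2), of "Y q"] Y q coord_inv_coord[OF c(1) q(2)]
      unfolding smooth_vector_field_on_def by simp
    then show ?thesis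
      using linear_eq_sum_Basis[OF has_derivative_linear[OF smooth_on_has_derivative[OF Fs x]],
          of "?Y x"] by simp
  qed
  have "smooth_on ?W (\<lambda>x. \<Sum>b\<in>Basis. (?Y x \<bullet> b) *\<^sub>R frechet_derivative ?F (at x) b)"
    unfolding smooth_on_def
    by (intro allI Ck_on_sum Ck_on_scaleR W Ck_on_linear[OF bounded_linear_inner_left]
        smooth_on_Ck[OF Ys] smooth_on_Ck[OF smooth_on_derivative[OF Fs]])
  then have "smooth_on ?W ?G"
    by (rule iffD1[OF smooth_on_cong[OF W(1)], rotated]) (rule G)
  from smooth_on_has_derivative[OF this W(2)]
  have G': "(?G has_derivative frechet_derivative ?G (at (snd c p))) (at (snd c p))" .
  note N' = smooth_map_has_derivative[OF N c]
  have D: "((\<lambda>x. B (?N x) (?G x)) has_derivative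
      (\<lambda>v. B (?N (snd c p)) (frechet_derivative ?G (at (snd c p)) v)
        + B (frechet_derivative ?N (at (snd c p)) v) (?G (snd c p)))) (at (snd c p))"
    by (rule bounded_bilinear.FDERIV[OF B N' G'])
  have D0: "((\<lambda>x. B (?N x) (?G x)) has_derivative (\<lambda>v. 0)) (at (snd c p))"
  proof (rule iffD2[OF has_derivative_cong_open[OF W]])
    show "B (?N x) (?G x) = 0" if "x \<in> ?W" for x
      using that NF Y coord_inv_coord[OF c(1)] unfolding smooth_vector_field_on_def by auto
  qed simp
  from fun_cong[OF has_derivative_unique[OF D D0], of "u c"] show ?thesis
    using differential_eq[OF c u G'] differential_eq[OF c u N'] coord_inv_coord[OF c] by simp
qed

text \<open>Pairing with \<open>N p\<close> annihilates the image of
  \<open>differential A F p\<close> and sends \<open>\<eta> p\<close> to 1, hence reads off the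
  transversal coefficient; the splitting \<open>dec\<close> is what makes such a coefficient
  exist.\<close>

lemma affine_metric_eq:
  assumes \<eta>: "B (N p) (\<eta> p) = 1"
    and dec: "\<And>z. \<exists>w\<in>tangent_space A p. \<exists>a. z = differential A F p w + a *\<^sub>R \<eta> p"
    and u: "u \<in> tangent_space A p" and v: "v \<in> tangent_space A p"
  shows "affine_metric A F \<eta> p u v = - B (differential A N p u) (differential A F p v)"
proof -
  interpret B: bounded_bilinear B by (rule B)
  have coeff: "a = - B (differential A N p u) (differential A F p v)"
    if "open U" "p \<in> U" "smooth_vector_field_on A U Y" "Y p = v" "w \<in> tangent_space A p"
      "differential A (\<lambda>q. differential A F q (Y q)) p u = differential A F p w + a *\<^sub>R \<eta> p"
    for U Y w a
    using pairing_derivative[OF that(1-3) u] that(4-6) NF[OF that(5)] \<eta>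
    by (simp add: B.add_right B.scaleR_right)
  show ?thesis
    unfolding affine_metric_def
  proof (rule the_equality)
    show "\<forall>U Y. open U \<and> p \<in> U \<and> smooth_vector_field_on A U Y \<and> Y p = v \<longrightarrow>
      (\<exists>w\<in>tangent_space A p. differential A (\<lambda>q. differential A F q (Y q)) p u
        = differential A F p w + (- B (differential A N p u) (differential A F p v)) *\<^sub>R \<eta> p)"
    proof (intro allI impI)
      fix U Y assume UY: "open U \<and> p \<in> U \<and> smooth_vector_field_on A U Y \<and> Y p = v"
      obtain w a where w: "w \<in> tangent_space A p"
        "differential A (\<lambda>q. differential A F q (Y q)) p u = differential A F p w + a *\<^sub>R \<eta> p"
        using dec by blast
      then have "a = - B (differential A N p u) (differential A F p v)"
        using coeff[of U Y w a] UY by blast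
      with w show "\<exists>w\<in>tangent_space A p. differential A (\<lambda>q. differential A F q (Y q)) p u
          = differential A F p w + (- B (differential A N p u) (differential A F p v)) *\<^sub>R \<eta> p"
        by blast
    qed
  next
    fix a
    assume a: "\<forall>U Y. open U \<and> p \<in> U \<and> smooth_vector_field_on A U Y \<and> Y p = v \<longrightarrow>
      (\<exists>w\<in>tangent_space A p. differential A (\<lambda>q. differential A F q (Y q)) p u
        = differential A F p w + a *\<^sub>R \<eta> p)"
    \<comment> \<open>Uniqueness needs an actual extension of v, since the condition on a would
      otherwise be vacuous; the field with constant coordinates in a chart serves.\<close>
    obtain c where c: "c \<in> A" "p \<in> fst c" using ex_chart by blast
    let ?Y = "\<lambda>q. tvec A c q (v c)"
    have Y: "open (fst c)" "p \<in> fst c" "smooth_vector_field_on A (fst c) ?Y" "?Y p = v"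
      using open_chart_domain[OF c(1)] c(2) smooth_tvec_field[OF c(1)] tangent_eq_tvec[OF c v] by blast+
    then obtain w where "w \<in> tangent_space A p"
      "differential A (\<lambda>q. differential A F q (?Y q)) p u = differential A F p w + a *\<^sub>R \<eta> p"
      using a[rule_format, of "fst c" ?Y] by blast
    with coeff[OF Y] show "a = - B (differential A N p u) (differential A F p v)" by blast
  qed
qed

lemma pairing_sym:
  assumes u: "u \<in> tangent_space A p" and v: "v \<in> tangent_space A p"
  shows "B (differential A N p u) (differential A F p v) = B (differential A N p v) (differential A F p u)"
proof -
  obtain c where c: "c \<in> A" "p \<in> fst c" using ex_chart by blast
  let ?W = "snd c ` fst c" and ?F = "F \<circ> coord_inv c" and ?N = "N \<circ> coord_inv c" and ?x = "snd c p"
  have W: "open ?W" "?x \<in> ?W" using open_chart_range c by auto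
  have Fs: "smooth_on ?W ?F" using F c unfolding smooth_map_def by blast
  have L: "bounded_linear (B (N p))" by (rule bounded_bilinear.bounded_linear_right[OF B])
  have gs: "smooth_on ?W (\<lambda>x. B (N p) (?F x))" by (rule smooth_on_linear[OF L W(1) Fs])
  have frL: "frechet_derivative (\<lambda>x. B (N p) (h x)) (at x) e = B (N p) (frechet_derivative h (at x) e)"
    if "smooth_on ?W h" "x \<in> ?W" for h x e
    using has_derivative_unique_frechet[OF bounded_linear.has_derivative[OF L smooth_on_has_derivative[OF that]]]
    by simp
  have key: "B (frechet_derivative ?N (at ?x) e') (frechet_derivative ?F (at ?x) e)
      = - frechet_derivative (\<lambda>y. frechet_derivative (\<lambda>x. B (N p) (?F x)) (at y) e) (at ?x) e'" for e e'
  proof -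
    let ?F' = "\<lambda>x. frechet_derivative ?F (at x) e"
    have Fs': "smooth_on ?W ?F'" by (rule smooth_on_derivative[OF Fs])
    have D: "((\<lambda>x. B (?N x) (?F' x)) has_derivative
        (\<lambda>v. B (?N ?x) (frechet_derivative ?F' (at ?x) v)
          + B (frechet_derivative ?N (at ?x) v) (?F' ?x))) (at ?x)"
      by (rule bounded_bilinear.FDERIV[OF B smooth_map_has_derivative[OF N c]
            smooth_on_has_derivative[OF Fs' W(2)]])
    have D0: "((\<lambda>x. B (?N x) (?F' x)) has_derivative (\<lambda>v. 0)) (at ?x)"
    proof (rule iffD2[OF has_derivative_cong_open[OF W]])
      show "B (?N x) (?F' x) = 0" if x: "x \<in> ?W" for x
      proof -
        obtain q where q: "q \<in> fst c" "x = snd c q" using x by blast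
        show ?thesis
          using NF[OF tvec_in_tangent_space[OF c(1) q(1), of e]] differential_tvec[OF F c(1) q(1)]
            coord_inv_coord[OF c(1) q(1)] q(2) by simp
      qed
    qed simp
    have "frechet_derivative (\<lambda>y. frechet_derivative (\<lambda>x. B (N p) (?F x)) (at y) e) (at ?x) e'
        = B (N p) (frechet_derivative ?F' (at ?x) e')"
      unfolding frL[OF Fs' W(2), symmetric]
      by (rule fun_cong[OF frechet_derivative_cong_open[OF W]]) (rule frL[OF Fs])
    then show ?thesis
      using fun_cong[OF has_derivative_unique[OF D D0], of e'] coord_inv_coord[OF c] by simp
  qed
  show ?thesis
    unfolding differential_coord[OF F c u] differential_coord[OF F c v]
      differential_coord[OF N c u] differential_coord[OF N c v] key
    using smooth_on_second_derivative_sym[OF W gs, of "v c" "u c"] by simp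
qed

end

section \<open>The conormal map\<close>

lemma linear_eq_0_on_axes:
  fixes L :: "real ^ 'n \<Rightarrow> 'b::real_vector"
  assumes "linear L" "\<And>i. L (axis i 1) = 0"
  shows "L v = 0"
proof -
  have "L b = 0" if "b \<in> Basis" for b
    using that assms(2) by (auto simp: Basis_vec_def)
  then show ?thesis using linear_eq_sum_Basis[OF assms(1), of v] by simp
qed

context
  fixes f \<xi> :: "'m \<Rightarrow> real ^ 'k"
  assumes aff: "affine_immersion A f \<xi>" and card: "CARD('k) = CARD('n) + 1"
begin

lemma f_smooth: "smooth_map A f" and \<xi>_smooth: "smooth_map A \<xi>"
  using aff unfolding affine_immersion_def immersion_def by blast+

lemma f_inj: "inj_on (differential A f p) (tangent_space A p)"
  using aff unfolding affine_immersion_def immersion_def by blast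

lemma f_decomposition:
  "\<exists>w\<in>tangent_space A p. \<exists>a. z = differential A f p w + a *\<^sub>R \<xi> p"
proof -
  have "z \<in> {x + y | x y. x \<in> differential A f p ` tangent_space A p \<and> y \<in> span {\<xi> p}}"
    using aff unfolding affine_immersion_def by blast
  then show ?thesis unfolding span_singleton by blast
qed

text \<open>\<open>\<xi> p\<close> and the image of the differential of f together span the target.
  This yields uniqueness of the conormal covector, invertibility of the matrix defining it, and all
  later identities between covectors.\<close>

lemma transversal_functional_unique:
  assumes "bounded_linear \<alpha>" "\<alpha> (\<xi> p) = 0" "\<And>w. w \<in> tangent_space A p \<Longrightarrow> \<alpha> (differential A f p w) = 0"
  shows "\<alpha> z = 0"
proof -
  interpret bounded_linear \<alpha> by (rule assms)
  obtain w a where "w \<in> tangent_space A p" "z = differential A f p w + a *\<^sub>R \<xi> p"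
    using f_decomposition by blast
  then show ?thesis using assms(2,3) by (simp add: add scaleR)
qed

lemma conormal_eqI:
  assumes "blinfun_apply \<alpha> (\<xi> p) = 1"
    and "\<And>u. u \<in> tangent_space A p \<Longrightarrow> blinfun_apply \<alpha> (differential A f p u) = 0"
  shows "conormal A f \<xi> p = \<alpha>"
  unfolding conormal_def
proof (rule the_equality)
  fix \<beta> :: "(real ^ 'k) \<Rightarrow>\<^sub>L real"
  assume \<beta>: "blinfun_apply \<beta> (\<xi> p) = 1 \<and> (\<forall>u\<in>tangent_space A p. blinfun_apply \<beta> (differential A f p u) = 0)"
  show "\<beta> = \<alpha>"
  proof (rule blinfun_eqI)
    fix z
    have "blinfun_apply (\<beta> - \<alpha>) z = 0"
    proof (rule transversal_functional_unique)
      show "bounded_linear (blinfun_apply (\<beta> - \<alpha>))" by (rule blinfun.bounded_linear_right)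
      show "blinfun_apply (\<beta> - \<alpha>) (\<xi> p) = 0" using assms \<beta> by (simp add: blinfun.diff_left)
      show "blinfun_apply (\<beta> - \<alpha>) (differential A f p w) = 0" if "w \<in> tangent_space A p" for w
        using assms(2)[OF that] \<beta> that by (simp add: blinfun.diff_left)
    qed
    then show "blinfun_apply \<beta> z = blinfun_apply \<alpha> z" by (simp add: blinfun.diff_left)
  qed
qed (simp add: assms)

text \<open>Reduces vanishing on the image of the tangent space to the finitely many coordinate
  derivatives of f, which are rows of the linear system for the conormal covector.\<close>

lemma f_differential_axes:
  assumes L: "linear L" and c: "c \<in> A" "p \<in> fst c"
    and ax: "\<And>i. L (frechet_derivative (f \<circ> coord_inv c) (at (snd c p)) (axis i 1)) = 0"
    and u: "u \<in> tangent_space A p"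
  shows "L (differential A f p u) = 0"
proof -
  let ?f' = "frechet_derivative (f \<circ> coord_inv c) (at (snd c p))"
  have "linear (\<lambda>e. L (?f' e))"
    using linear_compose[OF has_derivative_linear[OF smooth_map_has_derivative[OF f_smooth c]] L]
    by (simp add: o_def)
  from linear_eq_0_on_axes[OF this ax] show ?thesis
    by (simp only: differential_coord[OF f_smooth c u])
qed

text \<open>The conormal covector solves the linear system whose rows are \<open>\<xi>\<close> and the coordinate
  derivatives of \<open>f\<close>; Cramer's rule shows that it depends smoothly on the point.\<close>

lemma conormal_local:
  assumes c: "c \<in> A"
  shows "\<exists>n. smooth_on (snd c ` fst c) n \<and>
    (\<forall>p\<in>fst c. n (snd c p) \<bullet> \<xi> p = 1 \<and>
      (\<forall>u\<in>tangent_space A p. n (snd c p) \<bullet> differential A f p u = 0))"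
proof -
  \<comment> \<open>The equations are indexed by \<open>'n option\<close>, with \<open>None\<close>
    for \<xi> and \<open>Some i\<close> for the i-th coordinate derivative of f; a bijection with
    \<open>'k\<close> turns them into the rows of a square matrix.\<close>
  have "card (UNIV :: 'k set) = card (UNIV :: 'n option set)" using card by simp
  then obtain g :: "'k \<Rightarrow> 'n option" where g: "bij g"
    using finite_same_card_bij[of "UNIV :: 'k set" "UNIV :: 'n option set"] by auto
  define k0 where "k0 = inv g None"
  have k0: "g k0 = None" using g by (simp add: k0_def bij_is_surj surj_f_inv_f)
  let ?W = "snd c ` fst c" and ?f = "f \<circ> coord_inv c" and ?\<xi> = "\<xi> \<circ> coord_inv c"
  have W: "open ?W" using open_chart_range c by blast
  define r where "r = (\<lambda>x j. case g j of None \<Rightarrow> ?\<xi> x | Some i \<Rightarrow> frechet_derivative ?f (at x) (axis i 1))"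
  define M where "M = (\<lambda>x. \<chi> j. r x j)"
  \<comment> \<open>The right-hand side asks for the value 1 on \<xi> and 0 on the derivatives of f;
    \<open>D k\<close> is the Cramer numerator of component k.\<close>
  define b :: "real ^ 'k" where "b = axis k0 1"
  define D where "D = (\<lambda>k x. det (\<chi> i j. if j = k then b $ i else M x $ i $ j))"
  define n where "n = (\<lambda>x. \<Sum>k\<in>UNIV. (D k x * inverse (det (M x))) *\<^sub>R (axis k 1 :: real ^ 'k))"
  have fs: "smooth_on ?W ?f" and xs: "smooth_on ?W ?\<xi>"
    using f_smooth \<xi>_smooth c unfolding smooth_map_def by blast+
  have Ms: "Ck_on m ?W (\<lambda>x. M x $ i $ j)" for m i j
  proof -
    have "Ck_on m ?W (\<lambda>x. r x i)"
      using smooth_on_Ck[OF xs] smooth_on_Ck[OF smooth_on_derivative[OF fs]]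
      by (cases "g i") (simp_all add: r_def del: o_apply)
    from Ck_on_linear[OF bounded_linear_vec_nth W this] show ?thesis by (simp add: M_def)
  qed
  have detM: "det (M (snd c p)) \<noteq> 0" and row: "M (snd c p) $ k0 = \<xi> p"
    "M (snd c p) $ inv g (Some i) = frechet_derivative ?f (at (snd c p)) (axis i 1)"
    if p: "p \<in> fst c" for p i
  proof -
    show row0: "M (snd c p) $ k0 = \<xi> p"
      using k0 coord_inv_coord[OF c p] by (simp add: M_def r_def)
    show row: "M (snd c p) $ inv g (Some i) = frechet_derivative ?f (at (snd c p)) (axis i 1)" for i
      using g by (simp add: M_def r_def bij_is_surj surj_f_inv_f)
    \<comment> \<open>A kernel vector is orthogonal to every row, hence to \<xi> and to the image of
      the differential of f. These span, so it is orthogonal to itself.\<close>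
    have "y = 0" if y: "M (snd c p) *v y = 0" for y
    proof -
      have rows: "M (snd c p) $ j \<bullet> y = 0" for j
        using arg_cong[OF y, of "\<lambda>v. v $ j"] by (simp add: matrix_vector_mul_component)
      have lin: "bounded_linear (\<lambda>z. z \<bullet> y)" by (rule bounded_linear_inner_left)
      have "y \<bullet> y = 0"
      proof (rule transversal_functional_unique[OF lin])
        show "\<xi> p \<bullet> y = 0" using rows[of k0] row0 by simp
        show "differential A f p w \<bullet> y = 0" if "w \<in> tangent_space A p" for w
        proof (rule f_differential_axes[OF bounded_linear.linear[OF lin] c p _ that])
          show "frechet_derivative ?f (at (snd c p)) (axis i 1) \<bullet> y = 0" for i
            using rows[of "inv g (Some i)"] unfolding row .
        qed
      qed
      then show "y = 0" by simp
    qed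
    then show "det (M (snd c p)) \<noteq> 0"
      unfolding invertible_det_nz[symmetric] invertible_left_inverse matrix_left_invertible_ker by blast
  qed
  have Ds: "Ck_on m ?W (D k)" for m k
    unfolding D_def
  proof (rule Ck_on_det[OF W])
    show "Ck_on m ?W (\<lambda>x. (\<chi> i j. if j = k then b $ i else M x $ i $ j) $ i $ j)" for i j
      using Ms[of m i j] Ck_on_const[of m ?W "b $ i"] by (cases "j = k") simp_all
  qed
  have "smooth_on ?W n"
    unfolding n_def smooth_on_def
    by (intro allI Ck_on_sum Ck_on_scaleR Ck_on_mult Ck_on_inverse Ck_on_det Ck_on_const W Ds Ms)
      (use detM in blast)
  moreover have "n (snd c p) \<bullet> \<xi> p = 1 \<and> (\<forall>u\<in>tangent_space A p. n (snd c p) \<bullet> differential A f p u = 0)"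
    if p: "p \<in> fst c" for p
  proof -
    let ?x = "snd c p"
    have "n ?x = (\<chi> k. D k ?x / det (M ?x))"
      unfolding n_def scalar_mult_eq_scaleR[symmetric]
      using basis_expansion[of "\<chi> k. D k ?x / det (M ?x)"] by (simp add: divide_inverse)
    then have "M ?x *v n ?x = b"
      using cramer[OF detM[OF p], of "n ?x" b] by (simp add: D_def)
    then have Mn: "M ?x $ j \<bullet> n ?x = b $ j" for j
      by (simp flip: matrix_vector_mul_component)
    have "inv g (Some i) \<noteq> k0" for i
      using k0 surj_f_inv_f[OF bij_is_surj[OF g], of "Some i"] by auto
    then have "frechet_derivative ?f (at ?x) (axis i 1) \<bullet> n ?x = 0" for i
      using Mn[of "inv g (Some i)"] row(2)[OF p] by (simp add: b_def axis_def)
    then have "n ?x \<bullet> frechet_derivative ?f (at ?x) (axis i 1) = 0" for i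
      by (simp add: inner_commute)
    then have "n ?x \<bullet> differential A f p u = 0" if "u \<in> tangent_space A p" for u
      by (rule f_differential_axes[OF bounded_linear.linear[OF bounded_linear_inner_right] c p _ that])
    moreover have "n ?x \<bullet> \<xi> p = 1"
      using Mn[of k0] row(1)[OF p] by (simp add: b_def inner_commute)
    ultimately show ?thesis by blast
  qed
  ultimately show ?thesis by blast
qed

text \<open>Smoothness is checked chart by chart, where uniqueness of the conormal covector
  identifies it with the inner product against the Cramer solution.\<close>

lemma conormal_smooth: "smooth_map A (conormal A f \<xi>)"
  unfolding smooth_map_def
proof
  fix c assume c: "c \<in> A"
  obtain n where n: "smooth_on (snd c ` fst c) n"
    "\<And>p. p \<in> fst c \<Longrightarrow> n (snd c p) \<bullet> \<xi> p = 1"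
    "\<And>p u. p \<in> fst c \<Longrightarrow> u \<in> tangent_space A p \<Longrightarrow> n (snd c p) \<bullet> differential A f p u = 0"
    using conormal_local[OF c] by blast
  have "smooth_on (snd c ` fst c) (\<lambda>x. blinfun_inner_right (n x))"
    by (rule smooth_on_linear[OF bounded_linear_blinfun_inner_right open_chart_range[OF c] n(1)])
  then show "smooth_on (snd c ` fst c) (conormal A f \<xi> \<circ> coord_inv c)"
  proof (rule iffD1[OF smooth_on_cong[OF open_chart_range[OF c]], rotated])
    fix x assume "x \<in> snd c ` fst c"
    then obtain p where p: "p \<in> fst c" "x = snd c p" by blast
    have "conormal A f \<xi> p = blinfun_inner_right (n (snd c p))"
      by (rule conormal_eqI) (simp_all add: n p)
    then show "blinfun_inner_right (n x) = (conormal A f \<xi> \<circ> coord_inv c) x"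
      using p coord_inv_coord[OF c] by simp
  qed
qed

lemma conormal_\<xi>: "blinfun_apply (conormal A f \<xi> p) (\<xi> p) = 1"
  and conormal_f: "u \<in> tangent_space A p \<Longrightarrow> blinfun_apply (conormal A f \<xi> p) (differential A f p u) = 0"
proof -
  obtain c where c: "c \<in> A" "p \<in> fst c" using ex_chart by blast
  obtain n where n: "n (snd c p) \<bullet> \<xi> p = 1"
    "\<And>u. u \<in> tangent_space A p \<Longrightarrow> n (snd c p) \<bullet> differential A f p u = 0"
    using conormal_local[OF c(1)] c(2) by blast
  have "conormal A f \<xi> p = blinfun_inner_right (n (snd c p))"
    by (rule conormal_eqI) (simp_all add: n)
  then show "blinfun_apply (conormal A f \<xi> p) (\<xi> p) = 1"
    "u \<in> tangent_space A p \<Longrightarrow> blinfun_apply (conormal A f \<xi> p) (differential A f p u) = 0"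
    by (simp_all add: n)
qed

section \<open>The affine metric in terms of the conormal map\<close>

lemma affine_metric_conormal:
  assumes "u \<in> tangent_space A p" "v \<in> tangent_space A p"
  shows "affine_metric A f \<xi> p u v
    = - blinfun_apply (differential A (conormal A f \<xi>) p u) (differential A f p v)"
  by (rule affine_metric_eq[OF f_smooth conormal_smooth bounded_bilinear_blinfun_apply])
    (use conormal_f conormal_\<xi> f_decomposition assms in blast)+

lemma affine_metric_sym:
  assumes "u \<in> tangent_space A p" "v \<in> tangent_space A p"
  shows "affine_metric A f \<xi> p u v = affine_metric A f \<xi> p v u"
  using pairing_sym[OF f_smooth conormal_smooth bounded_bilinear_blinfun_apply conormal_f assms]
  by (simp add: affine_metric_conormal assms)

section \<open>Smoothness and differential of the map into the double space\<close>

lemma sigma_plus_has_derivative: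
  assumes c: "c \<in> A" "p \<in> fst c"
  shows "(sigma_plus A f \<xi> \<circ> coord_inv c has_derivative
    (\<lambda>e. (frechet_derivative (\<xi> \<circ> coord_inv c) (at (snd c p)) e,
      frechet_derivative (conormal A f \<xi> \<circ> coord_inv c) (at (snd c p)) e))) (at (snd c p))"
proof -
  have "sigma_plus A f \<xi> \<circ> coord_inv c = (\<lambda>x. ((\<xi> \<circ> coord_inv c) x, (conormal A f \<xi> \<circ> coord_inv c) x))"
    by (simp add: sigma_plus_def fun_eq_iff)
  then show ?thesis
    using has_derivative_Pair[OF smooth_map_has_derivative[OF \<xi>_smooth c]
        smooth_map_has_derivative[OF conormal_smooth c]] by simp
qed

lemma differential_sigma_plus:
  assumes u: "u \<in> tangent_space A p"
  shows "differential A (sigma_plus A f \<xi>) p u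
    = (differential A \<xi> p u, differential A (conormal A f \<xi>) p u)"
proof -
  obtain c where c: "c \<in> A" "p \<in> fst c" using ex_chart by blast
  show ?thesis
    unfolding differential_eq[OF c u sigma_plus_has_derivative[OF c]]
      differential_coord[OF \<xi>_smooth c u] differential_coord[OF conormal_smooth c u] ..
qed

lemma sigma_plus_smooth: "smooth_map A (sigma_plus A f \<xi>)"
  unfolding smooth_map_def smooth_on_def
proof (intro ballI allI)
  fix c k assume c: "c \<in> A"
  let ?W = "snd c ` fst c"
  have W: "open ?W" by (rule open_chart_range[OF c])
  have "Ck_on k ?W (\<xi> \<circ> coord_inv c)" "Ck_on k ?W (conormal A f \<xi> \<circ> coord_inv c)"
    using \<xi>_smooth conormal_smooth c unfolding smooth_map_def smooth_on_def by blast+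
  from Ck_on_add[OF W Ck_on_linear[OF bounded_linear_Pair[OF bounded_linear_ident bounded_linear_zero] W this(1)]
      Ck_on_linear[OF bounded_linear_Pair[OF bounded_linear_zero bounded_linear_ident] W this(2)]]
  show "Ck_on k ?W (sigma_plus A f \<xi> \<circ> coord_inv c)"
    by (simp add: sigma_plus_def o_def)
qed

section \<open>Consequences of the equiaffine condition\<close>

context
  assumes eq: "equiaffine A f \<xi>"
begin

text \<open>The conormal covector reads off the coefficient of \<xi>, and injectivity of the
  differential of f fixes the tangential part. This resolves the definite descriptions of both
  components, and the coefficient is then 0 by hypothesis.\<close>

lemma equiaffine_shape:
  assumes u: "u \<in> tangent_space A p"
  shows "affine_shape A f \<xi> p u \<in> tangent_space A p"
    and "differential A \<xi> p u = - differential A f p (affine_shape A f \<xi> p u)"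
proof -
  let ?\<nu> = "conormal A f \<xi> p"
  obtain w0 a where w0: "w0 \<in> tangent_space A p" "differential A \<xi> p u = differential A f p w0 + a *\<^sub>R \<xi> p"
    using f_decomposition by blast
  obtain c where c: "c \<in> A" "p \<in> fst c" using ex_chart by blast
  \<comment> \<open>The minus sign of the structure equation is absorbed by negating the coordinates
    in one chart.\<close>
  define w where "w = tvec A c p (- w0 c)"
  have w: "w \<in> tangent_space A p" unfolding w_def by (rule tvec_in_tangent_space[OF c])
  have "differential A f p w = - differential A f p w0"
    using linear_neg[OF has_derivative_linear[OF smooth_map_has_derivative[OF f_smooth c]]]
    unfolding w_def differential_tvec[OF f_smooth c] differential_coord[OF f_smooth c w0(1)] by simp
  with w0 have dw: "differential A \<xi> p u = - differential A f p w + a *\<^sub>R \<xi> p" by simp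
  have coeff: "b = blinfun_apply ?\<nu> (differential A \<xi> p u)"
    if "v \<in> tangent_space A p" "differential A \<xi> p u = - differential A f p v + b *\<^sub>R \<xi> p" for v b
    using conormal_f[OF that(1)] conormal_\<xi>[of p] unfolding that(2)
    by (simp add: blinfun.diff_right blinfun.scaleR_right)
  have "transversal_form A f \<xi> p u = a"
    unfolding transversal_form_def
    by (rule the_equality) (use w dw coeff[OF w dw] coeff in blast)+
  with eq u have a: "a = 0" unfolding equiaffine_def by auto
  have "affine_shape A f \<xi> p u = w"
    unfolding affine_shape_def
  proof (rule the_equality)
    show "w \<in> tangent_space A p \<and> (\<exists>a. differential A \<xi> p u = - differential A f p w + a *\<^sub>R \<xi> p)"
      using w dw by blast
  next
    fix v assume v: "v \<in> tangent_space A p \<and> (\<exists>a. differential A \<xi> p u = - differential A f p v + a *\<^sub>R \<xi> p)"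
    then obtain b where b: "differential A \<xi> p u = - differential A f p v + b *\<^sub>R \<xi> p" by blast
    have "b = a" using coeff[OF _ b] coeff[OF w dw] v by simp
    then have "differential A f p v = differential A f p w" using b dw by simp
    then show "v = w" using f_inj[of p] v w by (simp add: inj_on_eq_iff)
  qed
  then show "affine_shape A f \<xi> p u \<in> tangent_space A p"
    and "differential A \<xi> p u = - differential A f p (affine_shape A f \<xi> p u)"
    using w dw a by simp_all
qed

lemma conormal_differential_\<xi>:
  "u \<in> tangent_space A p \<Longrightarrow> blinfun_apply (conormal A f \<xi> p) (differential A \<xi> p u) = 0"
  by (simp add: equiaffine_shape conormal_f blinfun.minus_right)

lemma differential_conormal_\<xi>:
  assumes u: "u \<in> tangent_space A p"
  shows "blinfun_apply (differential A (conormal A f \<xi>) p u) (\<xi> p) = 0"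
proof -
  obtain c where c: "c \<in> A" "p \<in> fst c" using ex_chart by blast
  let ?N = "conormal A f \<xi> \<circ> coord_inv c" and ?X = "\<xi> \<circ> coord_inv c" and ?x = "snd c p"
  have D: "((\<lambda>x. blinfun_apply (?N x) (?X x)) has_derivative
      (\<lambda>v. blinfun_apply (?N ?x) (frechet_derivative ?X (at ?x) v)
        + blinfun_apply (frechet_derivative ?N (at ?x) v) (?X ?x))) (at ?x)"
    by (rule bounded_bilinear.FDERIV[OF bounded_bilinear_blinfun_apply
          smooth_map_has_derivative[OF conormal_smooth c] smooth_map_has_derivative[OF \<xi>_smooth c]])
  have D0: "((\<lambda>x. blinfun_apply (?N x) (?X x)) has_derivative (\<lambda>v. 0)) (at ?x)"
    by (simp add: conormal_\<xi>)
  show ?thesis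
    using fun_cong[OF has_derivative_unique[OF D D0], of "u c"] conormal_differential_\<xi>[OF u]
    unfolding differential_coord[OF conormal_smooth c u] differential_coord[OF \<xi>_smooth c u]
    by (simp add: coord_inv_coord[OF c])
qed

text \<open>This is \<open>pairing_sym\<close> with \<nu> in the role of F and \<xi> in the role of
  N; the flipped evaluation accounts for the reversed order of u and v.\<close>

lemma differential_conormal_\<xi>_sym:
  assumes "u \<in> tangent_space A p" "v \<in> tangent_space A p"
  shows "blinfun_apply (differential A (conormal A f \<xi>) p u) (differential A \<xi> p v)
    = blinfun_apply (differential A (conormal A f \<xi>) p v) (differential A \<xi> p u)"
  by (rule pairing_sym[OF conormal_smooth \<xi>_smooth
        bounded_bilinear.flip[OF bounded_bilinear_blinfun_apply] differential_conormal_\<xi> assms(2,1)])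

lemma sigma_plus_horizontal:
  assumes "u \<in> tangent_space A p"
  shows "differential A (sigma_plus A f \<xi>) p u \<in> horizontal_space (sigma_plus A f \<xi> p)"
  using conormal_differential_\<xi>[OF assms] differential_conormal_\<xi>[OF assms]
  by (simp add: differential_sigma_plus[OF assms] horizontal_space_def sigma_plus_def)

section \<open>Consequences of non-degeneracy\<close>

context
  assumes nondeg: "nondegenerate A f \<xi>"
begin

text \<open>By \<open>affine_metric_conormal\<close>, a vector killed by the differential of \<nu>
  lies in the radical of h. The difference of u and v is formed in the coordinates of one
  chart.\<close>

lemma conormal_inj:
  assumes u: "u \<in> tangent_space A p" and v: "v \<in> tangent_space A p"
    and uv: "differential A (conormal A f \<xi>) p u = differential A (conormal A f \<xi>) p v"
  shows "u = v"
proof -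
  obtain c where c: "c \<in> A" "p \<in> fst c" using ex_chart by blast
  define w where "w = tvec A c p (u c - v c)"
  have w: "w \<in> tangent_space A p" unfolding w_def by (rule tvec_in_tangent_space[OF c])
  have "differential A (conormal A f \<xi>) p w = 0"
    using uv linear_diff[OF has_derivative_linear[OF smooth_map_has_derivative[OF conormal_smooth c]]]
    unfolding w_def differential_tvec[OF conormal_smooth c] differential_coord[OF conormal_smooth c u]
      differential_coord[OF conormal_smooth c v] by simp
  then have "\<forall>z\<in>tangent_space A p. affine_metric A f \<xi> p w z = 0"
    using affine_metric_conormal[OF w] by simp
  then have "w = (\<lambda>c. 0)" using nondeg w unfolding nondegenerate_def by blast
  then have "w c = 0" by simp
  then have "u c = v c" unfolding w_def tvec_coord[OF c] by simp
  then have "tvec A c p (u c) = tvec A c p (v c)" by (rule arg_cong)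
  then show ?thesis unfolding tangent_eq_tvec[OF c u] tangent_eq_tvec[OF c v] .
qed

text \<open>Non-degeneracy makes \<open>u \<mapsto> (\<nu>\<^sub>* u)(f\<^sub>* e\<^sub>i)\<close> an injective, hence surjective,
  endomorphism of the coordinate space.\<close>

lemma conormal_decomposition:
  "\<exists>w\<in>tangent_space A p. \<exists>a. \<beta> = differential A (conormal A f \<xi>) p w + a *\<^sub>R conormal A f \<xi> p"
proof -
  obtain c where c: "c \<in> A" "p \<in> fst c" using ex_chart by blast
  let ?N' = "frechet_derivative (conormal A f \<xi> \<circ> coord_inv c) (at (snd c p))"
  let ?f' = "frechet_derivative (f \<circ> coord_inv c) (at (snd c p))"
  have N': "linear ?N'"
    by (rule has_derivative_linear[OF smooth_map_has_derivative[OF conormal_smooth c]])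
  define L :: "real ^ 'n \<Rightarrow> real ^ 'n" where "L = (\<lambda>e. \<chi> i. blinfun_apply (?N' e) (?f' (axis i 1)))"
  have L: "linear L"
    by (rule linearI) (simp_all add: L_def vec_eq_iff linear_add[OF N'] linear_cmul[OF N']
        blinfun.add_left blinfun.scaleR_left)
  \<comment> \<open>The covector \<open>?N' e\<close> then vanishes on the image of the differential
    of f, and it always vanishes on \<xi>; so it is zero and injectivity applies.\<close>
  have "e = 0" if "L e = 0" for e
  proof -
    let ?w = "tvec A c p e" and ?o = "tvec A c p 0"
    have w: "?w \<in> tangent_space A p" and o: "?o \<in> tangent_space A p"
      by (rule tvec_in_tangent_space[OF c])+
    have ax: "blinfun_apply (?N' e) (?f' (axis i 1)) = 0" for i
      using arg_cong[OF that, of "\<lambda>v. v $ i"] by (simp add: L_def)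
    have "blinfun_apply (?N' e) z = 0" for z
    proof (rule transversal_functional_unique[OF blinfun.bounded_linear_right])
      show "blinfun_apply (?N' e) (\<xi> p) = 0"
        using differential_conormal_\<xi>[OF w] unfolding differential_tvec[OF conormal_smooth c] .
      show "blinfun_apply (?N' e) (differential A f p u) = 0" if "u \<in> tangent_space A p" for u
        by (rule f_differential_axes[OF bounded_linear.linear[OF blinfun.bounded_linear_right] c ax that])
    qed
    then have "?N' e = 0" by (intro blinfun_eqI) simp
    then have "?w = ?o"
      by (intro conormal_inj[OF w o])
        (simp add: differential_tvec[OF conormal_smooth c] linear_0[OF N'])
    then have "?w c = ?o c" by (rule fun_cong)
    then show "e = 0" unfolding tvec_coord[OF c] .
  qed
  then have "inj L" using linear_injective_0[OF L] by blast
  then have "surj L" by (rule linear_injective_imp_surjective[OF L _ refl])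
  then obtain e where e: "(\<chi> i. blinfun_apply \<beta> (?f' (axis i 1))) = L e"
    by (rule surjD[THEN exE])
  let ?w = "tvec A c p e"
  have w: "?w \<in> tangent_space A p" by (rule tvec_in_tangent_space[OF c])
  have dw: "differential A (conormal A f \<xi>) p ?w = ?N' e" by (rule differential_tvec[OF conormal_smooth c])
  \<comment> \<open>Evaluation at \<xi>, where \<nu> is 1 and the image of its differential
    vanishes, forces this coefficient. On the image of the differential of f, where \<nu> vanishes,
    agreement with \<beta> is the choice of e.\<close>
  define a where "a = blinfun_apply \<beta> (\<xi> p)"
  let ?\<gamma> = "\<beta> - (?N' e + a *\<^sub>R conormal A f \<xi> p)"
  have "blinfun_apply ?\<gamma> z = 0" for z
  proof (rule transversal_functional_unique[OF blinfun.bounded_linear_right])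
    show "blinfun_apply ?\<gamma> (\<xi> p) = 0"
      using differential_conormal_\<xi>[OF w] unfolding dw
      by (simp add: blinfun.diff_left blinfun.add_left blinfun.scaleR_left conormal_\<xi> a_def)
    show "blinfun_apply ?\<gamma> (differential A f p u) = 0" if "u \<in> tangent_space A p" for u
    proof (rule f_differential_axes[OF bounded_linear.linear[OF blinfun.bounded_linear_right] c _ that])
      fix i
      have "blinfun_apply (conormal A f \<xi> p) (?f' (axis i 1)) = 0"
        using conormal_f[OF tvec_in_tangent_space[OF c]] unfolding differential_tvec[OF f_smooth c] .
      moreover have "blinfun_apply (?N' e) (?f' (axis i 1)) = blinfun_apply \<beta> (?f' (axis i 1))"
        using arg_cong[OF e[symmetric], of "\<lambda>v. v $ i"] by (simp add: L_def)
      ultimately show "blinfun_apply ?\<gamma> (?f' (axis i 1)) = 0"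
        by (simp add: blinfun.diff_left blinfun.add_left blinfun.scaleR_left)
    qed
  qed
  then have "?\<gamma> = 0" by (intro blinfun_eqI) simp
  then have "\<beta> = differential A (conormal A f \<xi>) p ?w + a *\<^sub>R conormal A f \<xi> p"
    unfolding dw by (simp only: right_minus_eq)
  with w show ?thesis by blast
qed

text \<open>Here \<nu> is both the map and its own transversal field, and \<xi> is the annihilating
  dual map. The minus sign in \<open>dual_form\<close> cancels the one in
  \<open>affine_metric_eq\<close>.\<close>

lemma dual_form_eq:
  assumes "u \<in> tangent_space A p" "v \<in> tangent_space A p"
  shows "dual_form A f \<xi> p u v
    = blinfun_apply (differential A (conormal A f \<xi>) p v) (differential A \<xi> p u)"
proof -
  have "affine_metric A (conormal A f \<xi>) (conormal A f \<xi>) p u v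
      = - blinfun_apply (differential A (conormal A f \<xi>) p v) (differential A \<xi> p u)"
  proof (rule affine_metric_eq[OF conormal_smooth \<xi>_smooth
        bounded_bilinear.flip[OF bounded_bilinear_blinfun_apply]])
    show "blinfun_apply (conormal A f \<xi> p) (\<xi> p) = 1" by (rule conormal_\<xi>)
    show "\<exists>w\<in>tangent_space A p. \<exists>a. \<beta> = differential A (conormal A f \<xi>) p w + a *\<^sub>R conormal A f \<xi> p" for \<beta>
      by (rule conormal_decomposition)
    show "blinfun_apply (differential A (conormal A f \<xi>) q w) (\<xi> q) = 0" if "w \<in> tangent_space A q" for q w
      using that by (rule differential_conormal_\<xi>)
  qed (rule assms)+
  then show ?thesis by (simp add: dual_form_def)
qed

text \<open>Substituting the structure equation for \<xi> puts the shape operator into the second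
  argument of h; symmetry of h moves it to the first.\<close>

lemma dual_form_shape:
  assumes u: "u \<in> tangent_space A p" and v: "v \<in> tangent_space A p"
  shows "dual_form A f \<xi> p u v = affine_metric A f \<xi> p (affine_shape A f \<xi> p u) v"
  using affine_metric_sym[OF equiaffine_shape(1)[OF u] v]
    affine_metric_conormal[OF v equiaffine_shape(1)[OF u]]
  by (simp add: dual_form_eq[OF u v] equiaffine_shape(2)[OF u] blinfun.minus_right)

end

end

end

end

section \<open>Horizontal vectors on the pseudosphere\<close>

lemma horizontal_subset_tangent: "horizontal_space z \<subseteq> psph_tangent z"
  by (auto simp: horizontal_space_def psph_tangent_def)

text \<open>Applying \<open>snd z\<close> to the first component reads off the Reeb coefficient,
  because it takes \<open>fst z\<close> to 1 and kills horizontal vectors. For a horizontal vector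
  the coefficient is 0, so its decomposition is the trivial one.\<close>

lemma psph_phi_horizontal:
  assumes z: "z \<in> pseudosphere" and w: "(w, \<beta>) \<in> horizontal_space z"
  shows "psph_phi z (w, \<beta>) = (w, - \<beta>)"
  unfolding psph_phi_def
proof (rule the_equality)
  show "\<exists>a w' \<beta>'. (w', \<beta>') \<in> horizontal_space z \<and> (w, \<beta>) = a *\<^sub>R reeb z + (w', \<beta>') \<and> (w, - \<beta>) = (w', - \<beta>')"
    by (rule exI[of _ 0]) (use w in simp)
next
  fix y assume "\<exists>a w' \<beta>'. (w', \<beta>') \<in> horizontal_space z \<and> (w, \<beta>) = a *\<^sub>R reeb z + (w', \<beta>') \<and> y = (w', - \<beta>')"
  then obtain a w' \<beta>' where h: "(w', \<beta>') \<in> horizontal_space z"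
    and x: "w = a *\<^sub>R fst z + w'" "\<beta> = - a *\<^sub>R snd z + \<beta>'" and y: "y = (w', - \<beta>')"
    by (auto simp: reeb_def)
  have "blinfun_apply (snd z) w = a"
    using h z unfolding x(1)
    by (auto simp: horizontal_space_def pseudosphere_def blinfun.add_right blinfun.scaleR_right)
  then have "a = 0" using w by (simp add: horizontal_space_def)
  then show "y = (w, - \<beta>)" using x y by simp
qed

theorem theorem3p5:
  fixes A :: "('m::{t2_space, second_countable_topology}, 'n::finite) chart set"
    and f \<xi> :: "'m \<Rightarrow> real ^ 'k"
  assumes "CARD('k) = CARD('n) + 1"
    and "oriented_atlas A"
    and "affine_immersion A f \<xi>"
    and "equiaffine A f \<xi>"
    and "nondegenerate A f \<xi>"
  shows "range (sigma_plus A f \<xi>) \<subseteq> pseudosphere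
    \<and> immersion A (sigma_plus A f \<xi>)
    \<and> (\<forall>p. \<forall>u\<in>tangent_space A p. \<forall>v\<in>tangent_space A p.
          induced_metric A (sigma_plus A f \<xi>) p u v = dual_form A f \<xi> p u v
        \<and> dual_form A f \<xi> p u v = affine_metric A f \<xi> p (affine_shape A f \<xi> p u) v)
    \<and> horizontal A (sigma_plus A f \<xi>)
    \<and> phi_anti_invariant A (sigma_plus A f \<xi>)"
proof -
  have A: "smooth_atlas A" using assms(2) unfolding oriented_atlas_def by blast
  note hyps = A assms(3,1,4,5) and affine = A assms(3,1) and equi = A assms(3,1,4)
  let ?\<sigma> = "sigma_plus A f \<xi>" and ?\<nu> = "conormal A f \<xi>"
  have \<sigma>: "?\<sigma> p \<in> pseudosphere" for p
    using conormal_\<xi>[OF affine] by (simp add: pseudosphere_def sigma_plus_def)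
  note d\<sigma> = differential_sigma_plus[OF affine]
  note hor = sigma_plus_horizontal[OF equi]
  \<comment> \<open>\<open>psph_metric\<close> equals \<open>split_form\<close> only on pairs of
    tangent vectors, so tangency accompanies every evaluation below.\<close>
  note tan = subsetD[OF horizontal_subset_tangent hor]
  note sym = differential_conormal_\<xi>_sym[OF equi]
  \<comment> \<open>Equality of the second components already suffices.\<close>
  have "inj_on (differential A ?\<sigma> p) (tangent_space A p)" for p
  proof (rule inj_onI)
    fix u v assume uv: "u \<in> tangent_space A p" "v \<in> tangent_space A p"
      "differential A ?\<sigma> p u = differential A ?\<sigma> p v"
    show "u = v"
      using uv(3) conormal_inj[OF hyps uv(1,2)] unfolding d\<sigma>[OF uv(1)] d\<sigma>[OF uv(2)] by simp
  qed
  then have "immersion A ?\<sigma>"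
    unfolding immersion_def using sigma_plus_smooth[OF affine] by blast
  moreover have "induced_metric A ?\<sigma> p u v = dual_form A f \<xi> p u v"
    if u: "u \<in> tangent_space A p" and v: "v \<in> tangent_space A p" for p u v
    using tan[OF u] tan[OF v] sym[OF u v]
    by (simp add: induced_metric_def psph_metric_def split_form_def d\<sigma>[OF u] d\<sigma>[OF v] dual_form_eq[OF hyps u v])
  moreover have "psph_metric (?\<sigma> p) (psph_phi (?\<sigma> p) (differential A ?\<sigma> p u)) (differential A ?\<sigma> p v) = 0"
    if u: "u \<in> tangent_space A p" and v: "v \<in> tangent_space A p" for p u v
  proof -
    let ?w = "differential A \<xi> p u" and ?\<beta> = "differential A ?\<nu> p u"
    have h: "(?w, ?\<beta>) \<in> horizontal_space (?\<sigma> p)" using hor[OF u] unfolding d\<sigma>[OF u] .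
    \<comment> \<open>Changing the sign of the second component keeps a horizontal vector tangent,
      so the metric can be evaluated on the image under \<phi>.\<close>
    then have "(?w, - ?\<beta>) \<in> psph_tangent (?\<sigma> p)"
      by (simp add: horizontal_space_def psph_tangent_def blinfun.minus_left)
    then show ?thesis
      using tan[OF v] sym[OF u v]
      by (simp add: d\<sigma>[OF u] d\<sigma>[OF v] psph_phi_horizontal[OF \<sigma> h] psph_metric_def split_form_def
          blinfun.minus_left)
  qed
  moreover have "dual_form A f \<xi> p u v = affine_metric A f \<xi> p (affine_shape A f \<xi> p u) v"
    if "u \<in> tangent_space A p" "v \<in> tangent_space A p" for p u v
    by (rule dual_form_shape[OF hyps that])
  ultimately show ?thesis
    unfolding horizontal_def phi_anti_invariant_def using \<sigma> hor by blast
qed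

end
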